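(* Let $W$ be a real JBW$^*$-triple, and let $M$ and $N$ be two non-zero $M$-summands of $W$ with $W=M\oplus^{\ell_\infty}N$; let $P$ denote the natural projection of $W$ onto $M$. Then for each complete tripotent $e$ in $W$ (equivalently, each extreme point of the closed unit ball of $W$), the elements $P(e)$ and $(Id-P)(e)$ are two orthogonal non-zero tripotents in $W$. Moreover, $P(e)$ is an extreme point of the closed unit ball $\mathcal{B}_M$ of $M$ and $(Id-P)(e)$ is an extreme point of the closed unit ball $\mathcal{B}_N$ of $N$.
   Context: A real JB$^*$-triple is a norm-closed real subspace of a complex JB$^*$-triple closed under the triple product $\{\cdot,\cdot,\cdot\}$; a real JBW$^*$-triple is one which is a dual Banach space. An element $e$ is a tripotent if $\{e,e,e\}=e$; the Peirce-$0$ space is $W_0(e)=\{x:\{e,e,x\}=0\}$, and $e$ is complete if $W_0(e)=\{0\}$. Elements $x,y$ are orthogonal if the operator $L(x,y)=\{x,y,\cdot\}$ is zero. $W=M\oplus^{\ell_\infty}N$ means $W=M\oplus N$ algebraically with $\|m+n\|=\max\{\|m\|,\|n\|\}$; such $M,N$ are called $M$-summands. *)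

theory Defs
  imports "HOL-Analysis.Analysis"
begin

text \<open>Complex Banach spaces are modelled as real Banach spaces (type class banach)
together with a complex structure J (multiplication by the imaginary unit).\<close>

definition complex_structure :: "('a::real_normed_vector \<Rightarrow> 'a) \<Rightarrow> bool" where
  "complex_structure J \<longleftrightarrow> linear J \<and> (\<forall>x. J (J x) = - x) \<and>
     (\<forall>a b x. norm (a *\<^sub>R x + b *\<^sub>R J x) = sqrt (a\<^sup>2 + b\<^sup>2) * norm x)"

definition cscale :: "('a::real_vector \<Rightarrow> 'a) \<Rightarrow> complex \<Rightarrow> 'a \<Rightarrow> 'a" where
  "cscale J c x = Re c *\<^sub>R x + Im c *\<^sub>R J x"

text \<open>Hermitian operator (Bonsall--Duncan): numerical range is real. The states at x
are the norm-one complex-linear bounded functionals phi with phi x = 1.\<close>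
definition hermitian_op :: "('a::real_normed_vector \<Rightarrow> 'a) \<Rightarrow> ('a \<Rightarrow> 'a) \<Rightarrow> bool" where
  "hermitian_op J T \<longleftrightarrow>
     (\<forall>x (\<phi>::'a \<Rightarrow> complex). norm x = 1 \<and> bounded_linear \<phi> \<and> (\<forall>y. \<phi> (J y) = \<i> * \<phi> y)
        \<and> onorm \<phi> = 1 \<and> \<phi> x = 1 \<longrightarrow> Im (\<phi> (T x)) = 0)"

text \<open>Spectrum of T contained in [0,infinity): T - c Id is bijective for all other c
(bounded inverse is then automatic by the open mapping theorem).\<close>
definition nonneg_spectrum :: "('a::real_vector \<Rightarrow> 'a) \<Rightarrow> ('a \<Rightarrow> 'a) \<Rightarrow> bool" where
  "nonneg_spectrum J T \<longleftrightarrow>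
     (\<forall>c. \<not> (Im c = 0 \<and> Re c \<ge> 0) \<longrightarrow> bij (\<lambda>x. T x - cscale J c x))"

definition JB_star_triple :: "('a::banach \<Rightarrow> 'a) \<Rightarrow> ('a \<Rightarrow> 'a \<Rightarrow> 'a \<Rightarrow> 'a) \<Rightarrow> bool" where
  "JB_star_triple J tp \<longleftrightarrow>
     complex_structure J \<and>
     (\<forall>y z. linear (\<lambda>x. tp x y z)) \<and>
     (\<forall>x z. linear (\<lambda>y. tp x y z)) \<and>
     (\<forall>x y z. tp x y z = tp z y x) \<and>
     (\<forall>x y z. tp (J x) y z = J (tp x y z)) \<and>
     (\<forall>x y z. tp x (J y) z = - J (tp x y z)) \<and>
     (\<exists>K. \<forall>x y z. norm (tp x y z) \<le> K * norm x * norm y * norm z) \<and>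
     (\<forall>a b x y z. tp a b (tp x y z) =
        tp (tp a b x) y z - tp x (tp b a y) z + tp x y (tp a b z)) \<and>
     (\<forall>a. hermitian_op J (tp a a) \<and> nonneg_spectrum J (tp a a)) \<and>
     (\<forall>a. norm (tp a a a) = norm a ^ 3)"

definition real_JB_star_triple ::
  "('a::banach \<Rightarrow> 'a) \<Rightarrow> ('a \<Rightarrow> 'a \<Rightarrow> 'a \<Rightarrow> 'a) \<Rightarrow> 'a set \<Rightarrow> bool" where
  "real_JB_star_triple J tp W \<longleftrightarrow> JB_star_triple J tp \<and> subspace W \<and> closed W \<and>
     (\<forall>x\<in>W. \<forall>y\<in>W. \<forall>z\<in>W. tp x y z \<in> W)"

definition dual_space_via :: "(('b::banach \<Rightarrow>\<^sub>L real) \<Rightarrow> 'a::real_normed_vector) \<Rightarrow> 'a set \<Rightarrow> bool" where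
  "dual_space_via \<Phi> W \<longleftrightarrow> linear \<Phi> \<and> range \<Phi> = W \<and> (\<forall>f. norm (\<Phi> f) = norm f)"

definition tripotent :: "('a \<Rightarrow> 'a \<Rightarrow> 'a \<Rightarrow> 'a) \<Rightarrow> 'a \<Rightarrow> bool" where
  "tripotent tp e \<longleftrightarrow> tp e e e = e"

definition peirce0 :: "('a::zero \<Rightarrow> 'a \<Rightarrow> 'a \<Rightarrow> 'a) \<Rightarrow> 'a set \<Rightarrow> 'a \<Rightarrow> 'a set" where
  "peirce0 tp W e = {x\<in>W. tp e e x = 0}"

definition complete_tripotent :: "('a::zero \<Rightarrow> 'a \<Rightarrow> 'a \<Rightarrow> 'a) \<Rightarrow> 'a set \<Rightarrow> 'a \<Rightarrow> bool" where
  "complete_tripotent tp W e \<longleftrightarrow> e \<in> W \<and> tripotent tp e \<and> peirce0 tp W e = {0}"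

definition orthogonal_in :: "('a::zero \<Rightarrow> 'a \<Rightarrow> 'a \<Rightarrow> 'a) \<Rightarrow> 'a set \<Rightarrow> 'a \<Rightarrow> 'a \<Rightarrow> bool" where
  "orthogonal_in tp W x y \<longleftrightarrow> (\<forall>z\<in>W. tp x y z = 0)"

definition linf_sum :: "'a::real_normed_vector set \<Rightarrow> 'a set \<Rightarrow> 'a set \<Rightarrow> bool" where
  "linf_sum W M N \<longleftrightarrow> subspace M \<and> subspace N \<and> M \<inter> N = {0} \<and>
     {m + n | m n. m \<in> M \<and> n \<in> N} = W \<and>
     (\<forall>m\<in>M. \<forall>n\<in>N. norm (m + n) = max (norm m) (norm n))"

end

theory Submission
  imports Defs
begin

text \<open>Write \<open>e = m + n\<close>. The argument uses only two estimates. First, a tripotent \<open>u\<close> is extreme up to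
its Peirce-0 space: if \<open>norm (u + x)\<close> and \<open>norm (u - x)\<close> are at most one, then \<open>{u,u,x} = 0\<close>.
Hence \<open>e\<close> is extreme in the ball of \<open>W\<close>, and so \<open>m\<close> and \<open>n\<close> are extreme in the balls of \<open>M\<close> and \<open>N\<close>.
Second, the odd functional calculus of \<open>m\<close> gives \<open>norm (m + y / 2) \<le> 1\<close> for \<open>y = m - {m,m,m}\<close>, while
\<open>norm (m + c y) > 1\<close> for \<open>c = 1 / norm y\<close>. The former forces the component of \<open>y\<close> in \<open>M\<close> to vanish, so
\<open>y\<close> lies in \<open>N\<close>, and then the latter contradicts \<open>norm (m + c y) = max (norm m) (c norm y)\<close> unless \<open>y = 0\<close>.
So \<open>m\<close> and \<open>n\<close> are tripotents, and the first estimate for \<open>n\<close> and \<open>x = m\<close> gives orthogonality.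

Both estimates come from the identity \<open>norm {x,x,x} = (norm x)\<^sup>3\<close>, which makes a seminorm on polynomials
behave like a \<open>C\<^sup>*\<close>-norm; positivity enters only as injectivity with bounded inverse of \<open>L(x,x) + \<epsilon>\<close>
for \<open>\<epsilon> > 0\<close>.\<close>

section \<open>Seminorms on polynomials satisfying the cube identity\<close>

lemma poly_ext:
  fixes p q :: "complex poly"
  assumes "\<And>x. poly p x = poly q x"
  shows "p = q"
  using assms by (simp add: poly_eq_poly_eq_iff[symmetric] fun_eq_iff)

text \<open>On the real axis this is pointwise complex conjugation, so it plays the part of the
  involution of a function algebra.\<close>

definition pcnj :: "complex poly \<Rightarrow> complex poly" where
  "pcnj = map_poly cnj"

lemma poly_pcnj [simp]: "poly (pcnj p) x = cnj (poly p (cnj x))"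
  by (simp add: pcnj_def)

lemma pcnj_simps [simp]:
  "pcnj 0 = 0" "pcnj 1 = 1" "pcnj (p + q) = pcnj p + pcnj q" "pcnj (p - q) = pcnj p - pcnj q"
  "pcnj (- p) = - pcnj p" "pcnj (p * q) = pcnj p * pcnj q" "pcnj (smult c p) = smult (cnj c) (pcnj p)"
  "pcnj (p ^ n) = pcnj p ^ n" "pcnj (monom c n) = monom (cnj c) n" "pcnj (pcnj p) = p"
  "pcnj [:c:] = [:cnj c:]" "pcnj (numeral k) = numeral k"
  by (rule poly_ext, simp add: poly_monom)+

section \<open>Moments of the symmetric binomial distribution\<close>

lemma sum_binomial_index:
  fixes p q :: "'a::comm_ring_1"
  shows "(\<Sum>j\<le>Suc n. of_nat (j * (Suc n choose j)) * p ^ j * q ^ (Suc n - j))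
      = of_nat (Suc n) * p * (p + q) ^ n"
proof -
  have "(\<Sum>j\<le>Suc n. of_nat (j * (Suc n choose j)) * p ^ j * q ^ (Suc n - j))
      = (\<Sum>j\<le>n. of_nat (Suc j * (Suc n choose Suc j)) * p ^ Suc j * q ^ (n - j))"
    by (subst sum.atMost_Suc_shift) simp
  also have "\<dots> = (\<Sum>j\<le>n. of_nat (Suc n * (n choose j)) * p ^ Suc j * q ^ (n - j))"
    by (simp only: Suc_times_binomial)
  also have "\<dots> = of_nat (Suc n) * p * (\<Sum>j\<le>n. of_nat (n choose j) * p ^ j * q ^ (n - j))"
    unfolding sum_distrib_left by (intro sum.cong) (simp_all add: algebra_simps)
  finally show ?thesis by (simp only: binomial_ring)
qed

text \<open>Up to the factor \<open>Suc n\<close>, the coefficients of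
  \<open>(p + q) ^ n * (p - q)\<close> are binomial weights times the centred index. Their absolute
  sum is a mean deviation, hence small against the total weight.\<close>

lemma sum_binomial_centered:
  fixes p q :: "'a::comm_ring_1"
  shows "(\<Sum>j\<le>Suc n. of_nat (Suc n choose j) * (2 * of_nat j - of_nat (Suc n)) * p ^ j * q ^ (Suc n - j))
      = of_nat (Suc n) * ((p + q) ^ n * (p - q))"
proof -
  have "(\<Sum>j\<le>Suc n. of_nat (Suc n choose j) * (2 * of_nat j - of_nat (Suc n)) * p ^ j * q ^ (Suc n - j))
     = 2 * (\<Sum>j\<le>Suc n. of_nat (j * (Suc n choose j)) * p ^ j * q ^ (Suc n - j))
     - of_nat (Suc n) * (\<Sum>j\<le>Suc n. of_nat (Suc n choose j) * p ^ j * q ^ (Suc n - j))"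
    unfolding sum_distrib_left sum_subtractf[symmetric]
    by (intro sum.cong) (simp_all add: algebra_simps)
  also have "\<dots> = of_nat (Suc n) * ((p + q) ^ n * (p - q))"
    unfolding sum_binomial_index binomial_ring[symmetric] by (simp add: algebra_simps)
  finally show ?thesis .
qed

text \<open>The variance, read off from the moments of the Bernstein polynomials at
  \<open>1/2\<close>.\<close>

lemma sum_binomial_variance:
  "(\<Sum>j\<le>n. real (n choose j) * (2 * real j - real n)\<^sup>2) = real n * 2 ^ n"
proof -
  have e: "(2::real) ^ n * Bernstein n j (1/2) = real (n choose j)" if "j \<le> n" for j
    using that by (simp add: Bernstein_def power_add[symmetric] power_one_over divide_simps)
  have "(\<Sum>j\<le>n. real (n choose j) * (2 * real j - real n)\<^sup>2)
      = (\<Sum>j\<le>n. 2 ^ n * Bernstein n j (1/2) * (2 * real j - real n)\<^sup>2)"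
    by (intro sum.cong) (simp_all add: e)
  also have "\<dots> = 2 ^ n * (4 * (\<Sum>j\<le>n. real j * (real j - 1) * Bernstein n j (1/2))
      + (4 - 4 * real n) * (\<Sum>j\<le>n. real j * Bernstein n j (1/2))
      + (real n)\<^sup>2 * (\<Sum>j\<le>n. Bernstein n j (1/2)))"
    unfolding sum_distrib_left sum.distrib[symmetric]
    by (intro sum.cong) (simp_all add: algebra_simps power2_eq_square)
  also have "\<dots> = real n * 2 ^ n"
    unfolding sum_k_Bernstein sum_kk_Bernstein sum_Bernstein
    by (simp add: algebra_simps power2_eq_square)
  finally show ?thesis .
qed

text \<open>Mean deviation is at most standard deviation. The arithmetic-geometric mean inequality
  is used with \<open>t = sqrt n\<close>, which balances its two terms.\<close>

lemma sum_binomial_abs_le: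
  "(\<Sum>j\<le>n. real (n choose j) * \<bar>2 * real j - real n\<bar>) \<le> sqrt (real n) * 2 ^ n"
proof (cases "n = 0")
  case False
  define t where "t = sqrt (real n)"
  have t: "t > 0" "t * t = real n" using False by (auto simp: t_def)
  have "\<bar>k\<bar> \<le> (k\<^sup>2 / t + t) / 2" for k :: real
  proof -
    have "0 \<le> (\<bar>k\<bar> - t)\<^sup>2" by simp
    then have "2 * \<bar>k\<bar> * t \<le> k\<^sup>2 + t * t" by (simp add: power2_eq_square algebra_simps)
    then show ?thesis using t by (simp add: field_simps)
  qed
  then have "(\<Sum>j\<le>n. real (n choose j) * \<bar>2 * real j - real n\<bar>)
      \<le> (\<Sum>j\<le>n. real (n choose j) * (((2 * real j - real n)\<^sup>2 / t + t) / 2))"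
    by (intro sum_mono mult_left_mono) auto
  also have "\<dots> = (\<Sum>j\<le>n. real (n choose j) * (2 * real j - real n)\<^sup>2) / (2 * t)
      + t / 2 * real (\<Sum>j\<le>n. n choose j)"
    unfolding of_nat_sum sum_divide_distrib sum_distrib_left sum.distrib[symmetric]
    by (intro sum.cong) (simp_all add: field_simps)
  also have "\<dots> = real n * 2 ^ n / (2 * t) + t / 2 * 2 ^ n"
    unfolding sum_binomial_variance choose_row_sum by simp
  also have "\<dots> = t * 2 ^ n" unfolding t(2)[symmetric] using t(1) by (simp add: field_simps)
  finally show ?thesis by (simp add: t_def)
qed simp

text \<open>A constant factor disappears under roots of growing order. The orders are powers of
  three because the estimates come from iterating the cube identity.\<close>

lemma le_if_powers_le:
  fixes x y K :: real
  assumes "0 \<le> x" "0 \<le> y" and le: "\<And>k::nat. x ^ (3 ^ k) \<le> K * y ^ (3 ^ k)"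
  shows "x \<le> y"
proof (rule ccontr)
  assume "\<not> x \<le> y"
  then have xy: "y < x" by simp
  show False
  proof (cases "y = 0")
    case True
    have "x ^ (3 ^ 0) \<le> K * y ^ (3 ^ 0)" by (rule le)
    with True xy show False by simp
  next
    case False
    with assms have y: "y > 0" by simp
    have b: "(x / y) ^ (3 ^ k) \<le> K" for k :: nat
      using le[of k] y by (simp add: power_divide field_simps)
    obtain n where n: "K < (x / y) ^ n" using real_arch_pow[of "x / y" K] xy y by auto
    have "(x / y) ^ n \<le> (x / y) ^ (3 ^ n)"
      using xy y by (intro power_increasing) (auto simp: less_imp_le)
    with n b[of n] show False by simp
  qed
qed

text \<open>A polynomial encodes the vector obtained by inserting elements \<open>z i\<close> for
  the powers, and \<open>s\<close> is the index shift in their triple products: \<open>s = 1\<close>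
  for the odd powers of an element, \<open>s = 0\<close> for powers with a unit.\<close>

locale cubic_seminorm =
  fixes N :: "complex poly \<Rightarrow> real" and s :: nat
  assumes N_add: "N (p + q) \<le> N p + N q"
    and N_smult: "N (smult c p) = cmod c * N p"
    and N_triple: "N (p * pcnj q * r * monom 1 s) \<le> N p * N q * N r"
    and N_cube: "N (p * pcnj p * p * monom 1 s) = N p ^ 3"
begin

lemma N_0 [simp]: "N 0 = 0"
  using N_smult[of 0 0] by simp

lemma N_minus [simp]: "N (- p) = N p"
  using N_smult[of "-1" p] by simp

lemma N_nonneg [simp]: "0 \<le> N p"
  using N_add[of p "- p"] by simp

text \<open>Bounds of multiplication operators, unlike \<open>N\<close>, are submultiplicative and
  equal to one at the unit polynomial, so arguments from Banach algebras apply to them.\<close>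

definition bd :: "complex poly \<Rightarrow> real \<Rightarrow> bool" where
  "bd g c \<longleftrightarrow> (\<forall>f. N (g * f) \<le> c * N f)"

lemma bdD: "bd g c \<Longrightarrow> N (g * f) \<le> c * N f"
  by (simp add: bd_def)

lemma bd_mono: "bd g c \<Longrightarrow> c \<le> d \<Longrightarrow> bd g d"
  unfolding bd_def by (meson N_nonneg mult_right_mono order_trans)

lemma bd_0: "bd 0 0" and bd_1: "bd 1 1"
  by (simp_all add: bd_def)

lemma bd_add: "bd g c \<Longrightarrow> bd h d \<Longrightarrow> bd (g + h) (c + d)"
  unfolding bd_def distrib_right by (meson N_add add_mono order_trans)

lemma bd_smult: "bd g c \<Longrightarrow> bd (smult a g) (cmod a * c)"
  unfolding bd_def by (simp add: N_smult mult.assoc mult_left_mono)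

lemma bd_minus: "bd g c \<Longrightarrow> bd (- g) c"
  unfolding bd_def by simp

lemma bd_diff: "bd g c \<Longrightarrow> bd h d \<Longrightarrow> bd (g - h) (c + d)"
  using bd_add[of g c "- h" d] bd_minus by simp

lemma bd_mult: "bd g c \<Longrightarrow> bd h d \<Longrightarrow> 0 \<le> c \<Longrightarrow> bd (g * h) (c * d)"
  unfolding bd_def mult.assoc by (meson mult_left_mono order_trans)

lemma bd_power: "bd g c \<Longrightarrow> 0 \<le> c \<Longrightarrow> bd (g ^ n) (c ^ n)"
  by (induction n) (auto simp: bd_1 intro: bd_mult)

lemma bd_sum: "finite A \<Longrightarrow> (\<And>i. i \<in> A \<Longrightarrow> bd (g i) (c i)) \<Longrightarrow> bd (\<Sum>i\<in>A. g i) (\<Sum>i\<in>A. c i)"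
  by (induction A rule: finite_induct) (auto simp: bd_0 intro: bd_add)

lemma bd_limit:
  assumes "\<And>\<eta>. 0 < \<eta> \<Longrightarrow> bd g (c + \<eta>)"
  shows "bd g c"
  unfolding bd_def
proof (intro allI)
  fix f
  show "N (g * f) \<le> c * N f"
  proof (rule field_le_epsilon)
    fix e :: real assume e: "e > 0"
    define \<eta> where "\<eta> = e / (N f + 1)"
    have pos: "0 < N f + 1" by (rule add_nonneg_pos) auto
    have "N (g * f) \<le> (c + \<eta>) * N f" using assms e pos by (intro bdD) (simp add: \<eta>_def)
    also have "\<dots> \<le> c * N f + e"
    proof -
      have "\<eta> * N f \<le> \<eta> * (N f + 1)" using e pos by (intro mult_left_mono) (auto simp: \<eta>_def)
      also have "\<dots> = e" using pos by (simp add: \<eta>_def)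
      finally show ?thesis by (simp add: algebra_simps)
    qed
    finally show "N (g * f) \<le> c * N f + e" .
  qed
qed

text \<open>The cube of \<open>g * f\<close> regroups as the triple product of
  \<open>g * pcnj g * f\<close>, \<open>f\<close> and \<open>g * f\<close>; one factor
  \<open>N (g * f)\<close> then cancels.\<close>

lemma C_star_inequality: "(N (g * f))\<^sup>2 \<le> N (g * pcnj g * f) * N f"
proof (cases "N (g * f) = 0")
  case False
  then have pos: "N (g * f) > 0" by (simp add: less_le)
  have "N (g * f) ^ 3 = N ((g * pcnj g * f) * pcnj f * (g * f) * monom 1 s)"
    unfolding N_cube[symmetric] by (simp add: mult_ac)
  also have "\<dots> \<le> N (g * pcnj g * f) * N f * N (g * f)" by (rule N_triple)
  finally have "(N (g * f))\<^sup>2 * N (g * f) \<le> (N (g * pcnj g * f) * N f) * N (g * f)"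
    by (simp add: power2_eq_square power3_eq_cube)
  then show ?thesis using pos by (simp add: mult_le_cancel_right)
qed simp

lemma bd_sqrt:
  assumes "bd (g * pcnj g) (c\<^sup>2)" "0 \<le> c"
  shows "bd g c"
  unfolding bd_def
proof (intro allI)
  fix f
  have "(N (g * f))\<^sup>2 \<le> N (g * pcnj g * f) * N f" by (rule C_star_inequality)
  also have "\<dots> \<le> c\<^sup>2 * N f * N f" by (intro mult_right_mono bdD assms) simp
  also have "\<dots> = (c * N f)\<^sup>2" by (simp add: power2_eq_square)
  finally show "N (g * f) \<le> c * N f" by (rule power2_le_imp_le) (simp add: assms(2))
qed

text \<open>For self-adjoint \<open>g\<close> each halving of the exponent is one use of
  \<open>bd_sqrt\<close>.\<close>

lemma bd_power_root:
  assumes "pcnj g = g" "0 \<le> c" "bd (g ^ (2 ^ k)) (c ^ (2 ^ k))"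
  shows "bd g c"
  using assms(3)
proof (induction k)
  case (Suc k)
  have "bd (g ^ (2 ^ k) * pcnj (g ^ (2 ^ k))) ((c ^ (2 ^ k))\<^sup>2)"
    using Suc.prems by (simp only: assms(1) pcnj_simps power_Suc mult_2 power_add power2_eq_square)
  then have "bd (g ^ (2 ^ k)) (c ^ (2 ^ k))" by (rule bd_sqrt) (simp add: assms(2))
  then show ?case by (rule Suc.IH)
qed simp

text \<open>Both \<open>h + i q\<close> and \<open>h - i q\<close> have
  \<open>h\<^sup>2 + q\<^sup>2\<close> as their squared modulus, and \<open>h\<close> is their
  mean.\<close>

lemma bd_summand_of_squares:
  assumes "pcnj h = h" "pcnj q = q" "bd (h\<^sup>2 + q\<^sup>2) (c\<^sup>2)" "0 \<le> c"
  shows "bd h c"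
proof -
  have *: "bd (h + smult (\<i> * \<sigma>) q) c" if "\<sigma> = 1 \<or> \<sigma> = -1" for \<sigma>
  proof (rule bd_sqrt)
    have "(h + smult (\<i> * \<sigma>) q) * pcnj (h + smult (\<i> * \<sigma>) q) = h\<^sup>2 + q\<^sup>2"
      using that by (intro poly_ext)
        (auto simp: assms(1,2) algebra_simps power2_eq_square)
    then show "bd ((h + smult (\<i> * \<sigma>) q) * pcnj (h + smult (\<i> * \<sigma>) q)) (c\<^sup>2)" using assms(3) by simp
  qed fact
  have "bd (smult (1/2) ((h + smult (\<i> * 1) q) + (h + smult (\<i> * -1) q))) (cmod (1/2) * (c + c))"
    by (intro bd_smult bd_add *) auto
  moreover have "smult (1/2) ((h + smult (\<i> * 1) q) + (h + smult (\<i> * -1) q)) = h"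
    by (rule poly_ext) simp
  ultimately show ?thesis by simp
qed

text \<open>The binomial expansion that shows the unit of a Banach algebra to be an extreme point
of its unit ball.\<close>

lemma bd_binomial:
  assumes "bd p 1" "bd q 1"
  shows "bd ((p + q) ^ n * (p - q)) (2 ^ Suc n / sqrt (real (Suc n)))"
proof -
  let ?a = "\<lambda>j. real (Suc n choose j) * (2 * real j - real (Suc n))"
  let ?S = "\<Sum>j\<le>Suc n. smult (of_real (?a j)) (p ^ j * q ^ (Suc n - j))"
  have "bd ?S (\<Sum>j\<le>Suc n. cmod (of_real (?a j)) * (1 ^ j * 1 ^ (Suc n - j)))"
    by (intro bd_sum bd_smult bd_mult bd_power assms) auto
  also have "(\<Sum>j\<le>Suc n. cmod (of_real (?a j)) * (1 ^ j * 1 ^ (Suc n - j)))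
      = (\<Sum>j\<le>Suc n. real (Suc n choose j) * \<bar>2 * real j - real (Suc n)\<bar>)"
    by (intro sum.cong) (simp_all only: norm_of_real abs_mult power_one mult_1_right abs_of_nat)
  finally have "bd ?S (sqrt (real (Suc n)) * 2 ^ Suc n)"
    by (rule bd_mono) (rule sum_binomial_abs_le)
  moreover have "?S = smult (of_nat (Suc n)) ((p + q) ^ n * (p - q))"
  proof -
    have "smult (of_real (?a j)) (p ^ j * q ^ (Suc n - j))
        = of_nat (Suc n choose j) * (2 * of_nat j - of_nat (Suc n)) * p ^ j * q ^ (Suc n - j)" for j
      by (rule poly_ext) (simp add: algebra_simps del: of_nat_Suc)
    then have "?S = of_nat (Suc n) * ((p + q) ^ n * (p - q))"
      by (simp only: sum_binomial_centered)
    also have "\<dots> = smult (of_nat (Suc n)) ((p + q) ^ n * (p - q))"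
      by (rule poly_ext) (simp del: of_nat_Suc)
    finally show ?thesis .
  qed
  ultimately have "bd (smult (of_nat (Suc n)) ((p + q) ^ n * (p - q))) (sqrt (real (Suc n)) * 2 ^ Suc n)"
    by simp
  from bd_smult[OF this, of "1 / of_nat (Suc n)"]
  have "bd ((p + q) ^ n * (p - q)) (cmod (1 / of_nat (Suc n)) * (sqrt (real (Suc n)) * 2 ^ Suc n))"
    by (simp del: of_nat_Suc power_Suc)
  also have "cmod (1 / of_nat (Suc n)) * (sqrt (real (Suc n)) * 2 ^ Suc n) = 2 ^ Suc n / sqrt (real (Suc n))"
    by (simp add: norm_divide real_div_sqrt divide_simps del: of_nat_Suc power_Suc)
  finally show ?thesis .
qed

text \<open>For \<open>p = 1 + g\<close> and \<open>q = 1 - g\<close> the sum is \<open>2\<close>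
  and the difference \<open>2 g\<close>, so \<open>bd_binomial\<close> bounds \<open>g\<close> by
  \<open>1 / sqrt (n + 1)\<close> for every \<open>n\<close>.\<close>

lemma unit_extreme:
  assumes "bd (1 + g) 1" "bd (1 - g) 1"
  shows "bd g 0"
proof (rule bd_limit)
  fix \<eta> :: real assume \<eta>: "\<eta> > 0"
  obtain n where n: "1 / sqrt (real (Suc n)) < \<eta>"
  proof -
    obtain n where "(1 / \<eta>)\<^sup>2 < real n" using reals_Archimedean2 by blast
    then have "1 / \<eta> < sqrt (real (Suc n))" by (intro real_less_rsqrt) simp
    then show ?thesis using \<eta> that by (simp add: field_simps)
  qed
  have "bd (smult (1 / 2 ^ Suc n) (((1 + g) + (1 - g)) ^ n * ((1 + g) - (1 - g))))
     (cmod (1 / 2 ^ Suc n) * (2 ^ Suc n / sqrt (real (Suc n))))"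
    by (intro bd_smult bd_binomial assms)
  also have "smult (1 / 2 ^ Suc n) (((1 + g) + (1 - g)) ^ n * ((1 + g) - (1 - g))) = g"
    by (rule poly_ext) simp
  also have "cmod (1 / 2 ^ Suc n) * (2 ^ Suc n / sqrt (real (Suc n))) = 1 / sqrt (real (Suc n))"
    by (simp add: norm_divide norm_power norm_mult)
  finally show "bd g (0 + \<eta>)" by (rule bd_mono) (use n in linarith)
qed

end

section \<open>Approximate square roots and positivity\<close>

text \<open>The iterates converge to \<open>1 - sqrt (1 - y)\<close>.\<close>

primrec sqrt_iter :: "complex poly \<Rightarrow> nat \<Rightarrow> complex poly" where
  "sqrt_iter y 0 = 0"
| "sqrt_iter y (Suc n) = smult (1/2) (y + (sqrt_iter y n)\<^sup>2)"

text \<open>The scalar iteration at \<open>y = 1\<close>. It dominates the polynomial iteration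
  because the recursion has non-negative coefficients.\<close>

primrec sqrt_bound :: "nat \<Rightarrow> real" where
  "sqrt_bound 0 = 0"
| "sqrt_bound (Suc n) = (1 + (sqrt_bound n)\<^sup>2) / 2"

lemma sqrt_bound_nonneg: "0 \<le> sqrt_bound n"
  by (cases n) auto

lemma sqrt_bound_le_1: "sqrt_bound n \<le> 1"
  by (induction n) (auto simp: sqrt_bound_nonneg power_le_one)

lemma sqrt_bound_mono: "sqrt_bound n \<le> sqrt_bound (Suc n)"
proof (induction n)
  case (Suc n)
  then have "(sqrt_bound n)\<^sup>2 \<le> (sqrt_bound (Suc n))\<^sup>2"
    by (intro power_mono sqrt_bound_nonneg)
  then show ?case by simp
qed simp

lemma sqrt_bound_step_small:
  assumes "0 < \<eta>"
  shows "\<exists>n. sqrt_bound (Suc n) - sqrt_bound n < \<eta>"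
proof -
  have "incseq sqrt_bound" using sqrt_bound_mono by (rule incseq_SucI)
  then obtain l where l: "sqrt_bound \<longlonglongrightarrow> l"
    using incseq_convergent[of sqrt_bound 1] sqrt_bound_le_1 by blast
  have "(\<lambda>n. sqrt_bound (Suc n) - sqrt_bound n) \<longlonglongrightarrow> l - l"
    by (intro tendsto_diff LIMSEQ_Suc l)
  then have "\<forall>\<^sub>F n in sequentially. sqrt_bound (Suc n) - sqrt_bound n < \<eta>"
    using assms by (intro order_tendstoD) auto
  then show ?thesis unfolding eventually_sequentially by blast
qed

lemma pcnj_sqrt_iter: "pcnj y = y \<Longrightarrow> pcnj (sqrt_iter y n) = sqrt_iter y n"
  by (induction n) simp_all

context cubic_seminorm
begin

lemma bd_sqrt_iter: "bd y 1 \<Longrightarrow> bd (sqrt_iter y n) (sqrt_bound n)"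
proof (induction n)
  case (Suc n)
  have "bd (smult (1/2) (y + (sqrt_iter y n)\<^sup>2)) (cmod (1/2) * (1 + (sqrt_bound n)\<^sup>2))"
    using Suc by (intro bd_smult bd_add bd_power sqrt_bound_nonneg) auto
  then show ?case by simp
qed (simp add: bd_0)

text \<open>Both iterations obey the same difference-of-squares recursion for their
  increments.\<close>

lemma bd_sqrt_iter_step:
  assumes "bd y 1"
  shows "bd (sqrt_iter y (Suc n) - sqrt_iter y n) (sqrt_bound (Suc n) - sqrt_bound n)"
proof (induction n)
  case 0
  then show ?case using bd_smult[OF assms, of "1/2"] by simp
next
  case (Suc n)
  let ?w = "sqrt_iter y" and ?b = sqrt_bound
  have "bd (smult (1/2) ((?w (Suc n) - ?w n) * (?w (Suc n) + ?w n)))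
      (cmod (1/2) * ((?b (Suc n) - ?b n) * (?b (Suc n) + ?b n)))"
    using Suc sqrt_bound_mono[of n] by (intro bd_smult bd_mult bd_add bd_sqrt_iter assms) auto
  moreover have "?w (Suc (Suc n)) - ?w (Suc n) = smult (1/2) ((?w (Suc n) - ?w n) * (?w (Suc n) + ?w n))"
  proof -
    have "?w (Suc (Suc n)) - ?w (Suc n) = smult (1/2) (y + (?w (Suc n))\<^sup>2) - smult (1/2) (y + (?w n)\<^sup>2)"
      by simp
    also have "\<dots> = smult (1/2) ((?w (Suc n) - ?w n) * (?w (Suc n) + ?w n))"
      by (rule poly_ext) (simp add: algebra_simps power2_eq_square del: sqrt_iter.simps)
    finally show ?thesis .
  qed
  moreover have "?b (Suc (Suc n)) - ?b (Suc n) = cmod (1/2) * ((?b (Suc n) - ?b n) * (?b (Suc n) + ?b n))"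
  proof -
    have "?b (Suc (Suc n)) - ?b (Suc n) = (1 + (?b (Suc n))\<^sup>2) / 2 - (1 + (?b n)\<^sup>2) / 2"
      by simp
    also have "\<dots> = cmod (1/2) * ((?b (Suc n) - ?b n) * (?b (Suc n) + ?b n))"
      by (simp add: algebra_simps power2_eq_square norm_divide diff_divide_distrib add_divide_distrib del: sqrt_bound.simps)
    finally show ?thesis .
  qed
  ultimately show ?case by metis
qed

text \<open>The error of \<open>1 - w n\<close> as a square root of \<open>y\<close> is exactly
  twice the increment \<open>w (n + 1) - w n\<close> of the iteration, and the increments become
  arbitrarily small.\<close>

lemma approx_sqrt:
  assumes "bd (1 - y) 1" "pcnj y = y" "0 < \<eta>"
  obtains r where "pcnj r = r" "bd (r\<^sup>2 - y) \<eta>"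
proof -
  let ?w = "sqrt_iter (1 - y)"
  obtain n where n: "sqrt_bound (Suc n) - sqrt_bound n < \<eta> / 2"
    using sqrt_bound_step_small[of "\<eta> / 2"] assms(3) by auto
  have "bd (smult 2 (?w (Suc n) - ?w n)) (cmod 2 * (sqrt_bound (Suc n) - sqrt_bound n))"
    by (intro bd_smult bd_sqrt_iter_step assms)
  moreover have "smult 2 (?w (Suc n) - ?w n) = (1 - ?w n)\<^sup>2 - y"
    by (rule poly_ext) (simp add: algebra_simps power2_eq_square)
  ultimately have "bd ((1 - ?w n)\<^sup>2 - y) (cmod 2 * (sqrt_bound (Suc n) - sqrt_bound n))"
    by metis
  then have "bd ((1 - ?w n)\<^sup>2 - y) \<eta>" by (rule bd_mono) (use n in \<open>simp del: sqrt_bound.simps\<close>)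
  moreover have "pcnj (1 - ?w n) = 1 - ?w n" using assms(2) by (simp add: pcnj_sqrt_iter)
  ultimately show ?thesis using that by blast
qed

lemma bd_perturb: "bd h c \<Longrightarrow> bd (h - g) \<eta> \<Longrightarrow> bd g (c + \<eta>)"
  using bd_diff[of h c "h - g" \<eta>] by simp

text \<open>Approximate \<open>1 - y * r\<^sup>2\<close> by \<open>p\<^sup>2\<close> and
  \<open>y\<close> by \<open>q\<^sup>2\<close>. Then \<open>p\<^sup>2 + (q * r)\<^sup>2\<close> is
  nearly \<open>1\<close>, which bounds \<open>p\<close>, and hence \<open>p\<^sup>2\<close>, by
  nearly one.\<close>

lemma bd_one_minus_mult_square:
  assumes "pcnj y = y" "pcnj r = r" "bd y 1" "bd (1 - y) 1" "bd r 1"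
  shows "bd (1 - y * r\<^sup>2) 1"
proof (rule bd_limit)
  fix \<eta> :: real assume "0 < \<eta>"
  define \<delta> where "\<delta> = \<eta> / 3"
  have \<delta>: "0 < \<delta>" using \<open>0 < \<eta>\<close> by (simp add: \<delta>_def)
  have r2: "bd (r\<^sup>2) 1" using bd_power[OF assms(5), of 2] by simp
  have "bd (1 - (1 - y * r\<^sup>2)) 1" using bd_mult[OF assms(3) r2] by simp
  then obtain p where p: "pcnj p = p" "bd (p\<^sup>2 - (1 - y * r\<^sup>2)) \<delta>"
    by (rule approx_sqrt[where \<eta> = \<delta>]) (use assms \<delta> in auto)
  obtain q where q: "pcnj q = q" "bd (q\<^sup>2 - y) \<delta>"
    by (rule approx_sqrt[where \<eta> = \<delta>]) (use assms \<delta> in auto)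
  have "bd ((p\<^sup>2 - (1 - y * r\<^sup>2)) + (q\<^sup>2 - y) * r\<^sup>2 + 1) (\<delta> + \<delta> * 1 + 1)"
    using \<delta> by (intro bd_add bd_mult p q r2 bd_1) auto
  moreover have "(p\<^sup>2 - (1 - y * r\<^sup>2)) + (q\<^sup>2 - y) * r\<^sup>2 + 1 = p\<^sup>2 + (q * r)\<^sup>2"
    by (simp add: algebra_simps power_mult_distrib)
  moreover have "\<delta> + \<delta> * 1 + 1 = (sqrt (1 + 2 * \<delta>))\<^sup>2" using \<delta> by simp
  ultimately have "bd (p\<^sup>2 + (q * r)\<^sup>2) ((sqrt (1 + 2 * \<delta>))\<^sup>2)" by metis
  then have "bd p (sqrt (1 + 2 * \<delta>))"
    by (rule bd_summand_of_squares[rotated 2]) (use p q assms \<delta> in auto)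
  from bd_power[OF this, of 2] have "bd (p\<^sup>2) (1 + 2 * \<delta>)" using \<delta> by simp
  from bd_perturb[OF this p(2)] show "bd (1 - y * r\<^sup>2) (1 + \<eta>)" by (simp add: \<delta>_def add.commute)
qed

text \<open>With \<open>q\<^sup>2\<close> near \<open>y\<close> and \<open>p\<^sup>2\<close> near
  \<open>1 - y\<close>, the elements \<open>q + i p\<close> and \<open>q - i p\<close> are nearly
  unitary, and the mean of their squares is \<open>q\<^sup>2 - p\<^sup>2\<close>, near
  \<open>2 * y - 1\<close>. The root of \<open>y\<close> is obtained from one of \<open>l y\<close>
  by rescaling, since the hypothesis concerns \<open>l y\<close>.\<close>

lemma bd_reflect:
  assumes "pcnj y = y" "bd y 1" "bd (1 - smult (of_real l) y) 1" "0 < l"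
  shows "bd (2 * y - 1) 1"
proof (rule bd_limit)
  fix \<eta> :: real assume "0 < \<eta>"
  define \<delta> where "\<delta> = \<eta> / (3 + 3 / l)"
  have \<delta>: "0 < \<delta>" using \<open>0 < \<eta>\<close> assms(4) by (simp add: \<delta>_def add_pos_pos)
  obtain p where p: "pcnj p = p" "bd (p\<^sup>2 - (1 - y)) \<delta>"
    by (rule approx_sqrt[where \<eta> = \<delta> and y = "1 - y"]) (use assms \<delta> in auto)
  obtain q' where q': "pcnj q' = q'" "bd (q'\<^sup>2 - smult (of_real l) y) \<delta>"
    by (rule approx_sqrt[where \<eta> = \<delta> and y = "smult (of_real l) y"]) (use assms \<delta> in auto)
  define q where "q = smult (of_real (1 / sqrt l)) q'"
  have q: "pcnj q = q" using q' by (simp add: q_def)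
  have q2: "bd (q\<^sup>2 - y) (\<delta> / l)"
  proof -
    have "smult (of_real (1 / l)) (q'\<^sup>2 - smult (of_real l) y) = q\<^sup>2 - y"
      using assms(4) by (intro poly_ext)
        (simp add: q_def field_simps power2_eq_square flip: of_real_mult)
    moreover have "cmod (of_real (1 / l)) * \<delta> = \<delta> / l" using assms(4) by (simp add: norm_divide)
    ultimately show ?thesis using bd_smult[OF q'(2), of "of_real (1 / l)"] by metis
  qed
  define \<epsilon> where "\<epsilon> = \<delta> + \<delta> / l"
  have \<epsilon>: "0 < \<epsilon>" using \<delta> assms(4) by (simp add: \<epsilon>_def add_pos_pos)
  have k: "bd (q + smult (\<i> * \<sigma>) p) (sqrt (1 + \<epsilon>))" if "\<sigma> = 1 \<or> \<sigma> = -1" for \<sigma>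
  proof (rule bd_sqrt)
    have "(q + smult (\<i> * \<sigma>) p) * pcnj (q + smult (\<i> * \<sigma>) p) = (p\<^sup>2 - (1 - y)) + (q\<^sup>2 - y) + 1"
      using that by (intro poly_ext) (auto simp: q p(1) algebra_simps power2_eq_square)
    moreover have "bd ((p\<^sup>2 - (1 - y)) + (q\<^sup>2 - y) + 1) (\<delta> + \<delta> / l + 1)"
      by (intro bd_add p q2 bd_1)
    moreover have "\<delta> + \<delta> / l + 1 = (sqrt (1 + \<epsilon>))\<^sup>2" using \<epsilon> by (simp add: \<epsilon>_def)
    ultimately show "bd ((q + smult (\<i> * \<sigma>) p) * pcnj (q + smult (\<i> * \<sigma>) p)) ((sqrt (1 + \<epsilon>))\<^sup>2)"
      by metis
  qed (use \<epsilon> in simp)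
  have "bd (smult (1/2) ((q + smult (\<i> * 1) p)\<^sup>2 + (q + smult (\<i> * -1) p)\<^sup>2)) 
     (cmod (1/2) * ((sqrt (1 + \<epsilon>))\<^sup>2 + (sqrt (1 + \<epsilon>))\<^sup>2))"
    by (intro bd_smult bd_add bd_power k) (use \<epsilon> in auto)
  moreover have "smult (1/2) ((q + smult (\<i> * 1) p)\<^sup>2 + (q + smult (\<i> * -1) p)\<^sup>2) = q\<^sup>2 - p\<^sup>2"
    by (rule poly_ext) (simp add: algebra_simps power2_eq_square)
  moreover have "cmod (1/2) * ((sqrt (1 + \<epsilon>))\<^sup>2 + (sqrt (1 + \<epsilon>))\<^sup>2) = 1 + \<epsilon>" using \<epsilon> by (simp add: norm_divide)
  ultimately have "bd (q\<^sup>2 - p\<^sup>2) (1 + \<epsilon>)" by metis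
  moreover have "bd ((q\<^sup>2 - p\<^sup>2) - (2 * y - 1)) (\<delta> / l + \<delta>)"
    using bd_diff[OF q2 p(2)] by (simp add: algebra_simps)
  ultimately have "bd (2 * y - 1) (1 + \<epsilon> + (\<delta> / l + \<delta>))" by (rule bd_perturb)
  moreover have "\<epsilon> + (\<delta> / l + \<delta>) \<le> \<eta>"
  proof -
    have "\<epsilon> + (\<delta> / l + \<delta>) \<le> \<delta> * (3 + 3 / l)"
      using \<delta> assms(4) by (simp add: \<epsilon>_def field_simps)
    also have "\<dots> = \<eta>"
    proof -
      have "3 + 3 / l \<noteq> 0" using assms(4) by (smt (verit) divide_pos_pos)
      then show ?thesis by (simp add: \<delta>_def)
    qed
    finally show ?thesis .
  qed
  ultimately show "bd (2 * y - 1) (1 + \<eta>)" by (elim bd_mono) simp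
qed

text \<open>Let \<open>\<delta>\<close> be the least bound of \<open>1 - X\<close> and suppose \<open>\<delta> > 1\<close>. Then \<open>b = (1 - X) / \<delta>\<close> behaves like an
element between \<open>0\<close> and \<open>1\<close>, so \<open>b\<^sup>n (1 - b)\<close> tends to \<open>0\<close>. Since \<open>1 - b\<close> is a multiple of
\<open>X + (\<delta> - 1)\<close>, also \<open>b\<^sup>n\<close> tends to \<open>0\<close>, and the bound \<open>\<delta>\<close> of \<open>1 - X\<close> was not the least.\<close>

lemma positive_if_bounded_below:
  assumes X: "bd [:0, 1:] 1"
    and below: "\<And>\<epsilon>. 0 < \<epsilon> \<Longrightarrow> \<exists>C. \<forall>f. N f \<le> C * N ([:of_real \<epsilon>, 1:] * f)"
  shows "bd (1 - [:0, 1:]) 1"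
proof -
  let ?R = "1 - [:0, 1:] :: complex poly"
  define D where "D = {d. 0 \<le> d \<and> bd ?R d}"
  define \<delta> where "\<delta> = Inf D"
  have "bd ?R (1 + 1)" by (intro bd_diff bd_1 X)
  then have ne: "2 \<in> D" by (simp add: D_def)
  have bb: "bdd_below D" by (rule bdd_belowI[of _ 0]) (simp add: D_def)
  have \<delta>0: "0 \<le> \<delta>" unfolding \<delta>_def by (rule cInf_greatest) (use ne in blast, simp add: D_def)
  have \<delta>: "bd ?R \<delta>"
  proof (rule bd_limit)
    fix \<eta> :: real assume "0 < \<eta>"
    then have "Inf D < \<delta> + \<eta>" by (simp add: \<delta>_def)
    then obtain d where d: "d \<in> D" "d < \<delta> + \<eta>" using cInf_lessD[of D] ne by auto
    then have "bd ?R d" by (simp add: D_def)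
    then show "bd ?R (\<delta> + \<eta>)" by (rule bd_mono) (use d in simp)
  qed
  have "\<delta> \<le> 1"
  proof (rule ccontr)
    assume "\<not> \<delta> \<le> 1"
    then have gt: "1 < \<delta>" by simp
    define b where "b = smult (of_real (1 / \<delta>)) ?R"
    have breal: "pcnj b = b" unfolding b_def by (rule poly_ext) simp
    have b1: "bd b 1" using bd_smult[OF \<delta>, of "of_real (1 / \<delta>)"] gt by (simp add: b_def norm_divide)
    have "1 - smult (of_real \<delta>) b = [:0, 1:]" using gt by (simp add: b_def)
    then have refl: "bd (2 * b - 1) 1" using gt X by (intro bd_reflect[of b \<delta>] breal b1) auto
    obtain C where C: "\<And>f. N f \<le> C * N ([:of_real (\<delta> - 1), 1:] * f)" using below[of "\<delta> - 1"] gt by auto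
    define K where "K = max C 1 * \<delta>"
    have Kpos: "0 < K" using gt by (simp add: K_def)
    have Xb: "[:of_real (\<delta> - 1), 1:] = smult (of_real \<delta>) (1 - b)"
      using gt by (intro poly_ext) (simp add: b_def field_simps)
    \<comment> \<open>Apply \<open>bd_binomial\<close> to \<open>1\<close> and
      \<open>2 * b - 1\<close>: their sum is \<open>2 * b\<close> and their difference
      \<open>2 * (1 - b)\<close>.\<close>
    have decay: "bd (b ^ n) (K / sqrt (real (Suc n)))" for n
      unfolding bd_def
    proof (intro allI)
      fix f
      have "N (b ^ n * f) \<le> C * N ([:of_real (\<delta> - 1), 1:] * (b ^ n * f))" by (rule C)
      also have "\<dots> \<le> max C 1 * N ([:of_real (\<delta> - 1), 1:] * (b ^ n * f))"
        by (rule mult_right_mono) auto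
      also have "[:of_real (\<delta> - 1), 1:] * (b ^ n * f)
          = smult (of_real \<delta> / 2 ^ Suc n) (((1 + (2 * b - 1)) ^ n * (1 - (2 * b - 1))) * f)"
        unfolding Xb by (rule poly_ext) (simp add: power_mult_distrib algebra_simps)
      also have "max C 1 * N \<dots> = max C 1 * (\<delta> / 2 ^ Suc n) * N (((1 + (2 * b - 1)) ^ n * (1 - (2 * b - 1))) * f)"
        using gt by (simp add: N_smult norm_divide norm_mult norm_power)
      also have "\<dots> \<le> max C 1 * (\<delta> / 2 ^ Suc n) * ((2 ^ Suc n / sqrt (real (Suc n))) * N f)"
        by (intro mult_left_mono bdD bd_binomial bd_1 refl) (use gt in auto)
      also have "\<dots> = K / sqrt (real (Suc n)) * N f"
        by (simp add: K_def field_simps del: of_nat_Suc)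
      finally show "N (b ^ n * f) \<le> K / sqrt (real (Suc n)) * N f" .
    qed
    \<comment> \<open>The exponent will be a power of two, so that \<open>bd_power_root\<close>
      turns a bound \<open>1/2\<close> for the power into a bound \<open>t < 1\<close> for
      \<open>b\<close>.\<close>
    obtain k where k: "(2 * K)\<^sup>2 < real k" using reals_Archimedean2 by blast
    have "real k \<le> real (Suc (2 ^ k))"
      using less_exp[of k] by (simp only: of_nat_le_iff)
    with k have "2 * K < sqrt (real (Suc (2 ^ k)))" by (intro real_less_rsqrt) linarith
    then have "K / sqrt (real (Suc (2 ^ k))) \<le> 1 / 2"
      using Kpos by (auto intro!: mult_imp_div_pos_le simp del: of_nat_Suc)
    then have half: "bd (b ^ (2 ^ k)) (1 / 2)" by (rule bd_mono[OF decay])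
    define t where "t = root (2 ^ k) (1 / 2)"
    have t: "0 \<le> t" "t < 1" "t ^ (2 ^ k) = 1 / 2" by (simp_all add: t_def)
    have "bd b t" by (rule bd_power_root[of b t k]) (use breal t half in \<open>simp_all only: t(3)\<close>)
    from bd_smult[OF this, of "of_real \<delta>"] have "bd ?R (\<delta> * t)"
      using gt by (simp add: b_def)
    then have "\<delta> * t \<in> D" using t gt by (simp add: D_def)
    then have "\<delta> \<le> \<delta> * t" unfolding \<delta>_def by (intro cInf_lower bb)
    with t gt show False by simp
  qed
  with \<delta> show ?thesis by (rule bd_mono)
qed

end

locale positive_cubic_seminorm = cubic_seminorm N 1 for N +
  assumes bd_X: "bd [:0, 1:] 1" and bd_R: "bd (1 - [:0, 1:]) 1"
begin

text \<open>In this locale the indeterminate stands for \<open>t\<^sup>2\<close> with \<open>t \<in> [0,1]\<close>, and \<open>N p\<close> for the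
supremum of \<open>\<bar>t * p (t\<^sup>2)\<bar>\<close>.\<close>

lemma N_three_halves: "N [:3/2, -1/2:] \<le> 1"
proof -
  let ?X = "[:0, 1:] :: complex poly" and ?R = "1 - [:0, 1:] :: complex poly" and ?g = "[:3/2, -1/2:] :: complex poly"
  have real: "pcnj ?R = ?R" by (rule poly_ext) simp
  \<comment> \<open>With \<open>R = 1 - X\<close> one has
    \<open>g\<^sup>2 X = 1 - (3/4) R\<^sup>2 - (1/4) R\<^sup>3\<close>, a convex combination of
    \<open>1 - R\<^sup>2\<close> and \<open>1 - R\<^sup>3\<close>.\<close>
  have "bd (1 - 1 * ?R\<^sup>2) 1"
    by (rule bd_one_minus_mult_square) (use bd_1 bd_0 bd_R real in \<open>auto intro: bd_mono\<close>)
  moreover have "bd (1 - ?R * ?R\<^sup>2) 1"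
    by (rule bd_one_minus_mult_square) (use bd_X bd_R real in auto)
  ultimately have "bd (smult (3/4) (1 - 1 * ?R\<^sup>2) + smult (1/4) (1 - ?R * ?R\<^sup>2)) (cmod (3/4) * 1 + cmod (1/4) * 1)"
    by (intro bd_add bd_smult)
  moreover have "smult (3/4) (1 - 1 * ?R\<^sup>2) + smult (1/4) (1 - ?R * ?R\<^sup>2) = ?g * ?g * ?X"
    by (rule poly_ext) (simp add: algebra_simps power2_eq_square)
  ultimately have "bd (?g * ?g * ?X) 1" by (simp add: norm_divide)
  have "N ?g ^ 3 = N (?g * ?g * ?X * ?g)"
    by (subst N_cube[symmetric], rule arg_cong[where f = N], rule poly_ext) (simp add: poly_monom algebra_simps)
  also have "\<dots> \<le> 1 * N ?g" by (rule bdD) fact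
  finally have "N ?g ^ 3 \<le> N ?g" by simp
  then show ?thesis using power_increasing[of 1 3 "N ?g"] power_strict_increasing[of 1 3 "N ?g"]
    by (force simp: not_le[symmetric])
qed

text \<open>For \<open>k = h + i q\<close> or \<open>h - i q\<close> the squared modulus is close to
  \<open>g\<^sup>2\<close>, so the cube of \<open>k\<close> is close to the triple product of
  \<open>g\<close>, \<open>g\<close> and \<open>k\<close>. This gives
  \<open>(N k)\<^sup>2 \<le> (N g)\<^sup>2 + \<eta>\<close>, and \<open>h\<close> is the mean of the
  two choices of \<open>k\<close>.\<close>

lemma N_le_if_sum_of_squares:
  assumes "pcnj h = h" "pcnj g = g"
    and approx: "\<And>\<eta>. 0 < \<eta> \<Longrightarrow> \<exists>q. pcnj q = q \<and> bd (h\<^sup>2 + q\<^sup>2 - g\<^sup>2) \<eta>"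
  shows "N h \<le> N g"
proof (rule power2_le_imp_le)
  show "(N h)\<^sup>2 \<le> (N g)\<^sup>2"
  proof (rule field_le_epsilon)
    fix \<eta> :: real assume \<eta>: "0 < \<eta>"
    obtain q where q: "pcnj q = q" "bd (h\<^sup>2 + q\<^sup>2 - g\<^sup>2) \<eta>" using approx[OF \<eta>] by blast
    have k: "N (h + smult (\<i> * \<sigma>) q) \<le> sqrt ((N g)\<^sup>2 + \<eta>)" if "\<sigma> = 1 \<or> \<sigma> = -1" for \<sigma>
    proof (cases "N (h + smult (\<i> * \<sigma>) q) = 0")
      case False
      let ?k = "h + smult (\<i> * \<sigma>) q"
      have pos: "0 < N ?k" using False by (simp add: less_le)
      have "N ?k ^ 3 = N ((g * pcnj g * ?k * monom 1 1) + (h\<^sup>2 + q\<^sup>2 - g\<^sup>2) * (monom 1 1 * ?k))"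
        by (subst N_cube[symmetric], rule arg_cong[where f = N], rule poly_ext)
          (use that in \<open>auto simp: assms(1,2) q(1) algebra_simps power2_eq_square\<close>)
      also have "\<dots> \<le> N (g * pcnj g * ?k * monom 1 1) + N ((h\<^sup>2 + q\<^sup>2 - g\<^sup>2) * (monom 1 1 * ?k))" by (rule N_add)
      also have "\<dots> \<le> N g * N g * N ?k + \<eta> * N ([:0, 1:] * ?k)"
        using bdD[OF q(2), of "monom 1 1 * ?k"] N_triple[of g g ?k] by (simp add: monom_Suc)
      also have "\<eta> * N ([:0, 1:] * ?k) \<le> \<eta> * (1 * N ?k)"
        using \<eta> by (intro mult_left_mono bdD bd_X) auto
      finally have "(N ?k)\<^sup>2 * N ?k \<le> ((N g)\<^sup>2 + \<eta>) * N ?k"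
        by (simp add: power2_eq_square power3_eq_cube algebra_simps)
      then have "(N ?k)\<^sup>2 \<le> (N g)\<^sup>2 + \<eta>" using pos by (simp add: mult_le_cancel_right)
      then show ?thesis by (rule real_le_rsqrt)
    qed (use \<eta> in simp)
    have "N h = N (smult (1/2) ((h + smult (\<i> * 1) q) + (h + smult (\<i> * -1) q)))"
      by (rule arg_cong[where f = N], rule poly_ext) simp
    also have "\<dots> \<le> (N (h + smult (\<i> * 1) q) + N (h + smult (\<i> * -1) q)) / 2"
      using N_add[of "h + smult (\<i> * 1) q" "h + smult (\<i> * -1) q"] by (simp only: N_smult) (simp add: norm_divide)
    also have "\<dots> \<le> sqrt ((N g)\<^sup>2 + \<eta>)" using k[of 1] k[of "-1"] by simp
    finally have "(N h)\<^sup>2 \<le> (sqrt ((N g)\<^sup>2 + \<eta>))\<^sup>2" by (intro power_mono) auto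
    then show "(N h)\<^sup>2 \<le> (N g)\<^sup>2 + \<eta>" using \<eta> by simp
  qed
qed simp

text \<open>The squares of the two sides differ by \<open>1 + 2 c - (2 c X + R\<^sup>2)\<close>,
  where \<open>R = 1 - X\<close>. Dividing by \<open>1 + 2 c\<close> gives an element within
  distance one of the unit, which has approximate square roots.\<close>

lemma N_one_minus_X_le:
  assumes "0 < c"
  shows "sqrt (c\<^sup>2 + 1) * N (1 - [:0, 1:]) \<le> N (1 + smult (of_real c) (1 - [:0, 1:]))"
proof -
  let ?X = "[:0, 1:] :: complex poly" and ?R = "1 - [:0, 1:] :: complex poly"
  let ?g = "1 + smult (of_real c) ?R" and ?h = "smult (of_real (sqrt (c\<^sup>2 + 1))) ?R"
  let ?l = "1 + 2 * c"
  define y where "y = smult (of_real (1 / ?l)) (?g\<^sup>2 - ?h\<^sup>2)"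
  have R: "pcnj ?R = ?R" by (rule poly_ext) simp
  have gh: "pcnj ?g = ?g" "pcnj ?h = ?h" using R by (simp_all only: pcnj_simps complex_cnj_complex_of_real)
  have y: "pcnj y = y" using gh by (simp only: y_def pcnj_simps complex_cnj_complex_of_real)
  have "bd (smult (of_real (1 / ?l)) (smult (of_real (2 * c)) ?X + ?R\<^sup>2))
      (cmod (of_real (1 / ?l)) * (cmod (of_real (2 * c)) * 1 + 1\<^sup>2))"
    by (intro bd_smult bd_add bd_X bd_power bd_R) simp
  moreover have "cmod (of_real (1 / ?l)) * (cmod (of_real (2 * c)) * 1 + 1\<^sup>2) = 1"
    using assms by (simp only: norm_of_real) (simp add: field_simps)
  moreover have "smult (of_real (1 / ?l)) (smult (of_real (2 * c)) ?X + ?R\<^sup>2) = 1 - y"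
  proof (rule poly_ext)
    fix x
    have s: "complex_of_real (sqrt (c\<^sup>2 + 1)) * complex_of_real (sqrt (c\<^sup>2 + 1)) = of_real (c\<^sup>2 + 1)"
      unfolding of_real_mult[symmetric] by (rule arg_cong[where f = of_real]) simp
    have "complex_of_real ?l \<noteq> 0" unfolding of_real_eq_0_iff using assms by simp
    then have l: "1 + 2 * complex_of_real c \<noteq> 0" by simp
    define C where "C = complex_of_real c"
    define E where "E = complex_of_real (1 / ?l)"
    have E: "E * (1 + 2 * C) = 1" using l by (simp add: E_def C_def)
    have "poly (?g\<^sup>2 - ?h\<^sup>2) x = (1 + C * (1 - x))\<^sup>2 - (C\<^sup>2 + 1) * (1 - x)\<^sup>2"
      using s by (simp add: power_mult_distrib power2_eq_square C_def)
    also have "\<dots> = (1 + 2 * C) - (2 * C * x + (1 - x)\<^sup>2)" by algebra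
    finally have "poly y x = E * ((1 + 2 * C) - (2 * C * x + (1 - x)\<^sup>2))"
      by (simp only: y_def poly_smult E_def)
    then have "poly (1 - y) x = E * (2 * C * x + (1 - x)\<^sup>2)"
      using E by (simp only: right_diff_distrib poly_diff poly_1) simp
    then show "poly (smult (of_real (1 / ?l)) (smult (of_real (2 * c)) ?X + ?R\<^sup>2)) x = poly (1 - y) x"
      by (simp only: poly_smult E_def[symmetric]) (simp add: C_def)
  qed
  ultimately have y1: "bd (1 - y) 1" by metis
  have "N ?h \<le> N ?g"
  proof (rule N_le_if_sum_of_squares[OF gh(2,1)])
    fix \<eta> :: real assume "0 < \<eta>"
    then obtain r where r: "pcnj r = r" "bd (r\<^sup>2 - y) (\<eta> / ?l)"
      using assms by (metis approx_sqrt[OF y1 y] add_pos_pos divide_pos_pos mult_pos_pos zero_less_numeral zero_less_one)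
    let ?q = "smult (of_real (sqrt ?l)) r"
    have "bd (smult (of_real ?l) (r\<^sup>2 - y)) (cmod (of_real ?l) * (\<eta> / ?l))" by (intro bd_smult r)
    moreover have "cmod (of_real ?l) * (\<eta> / ?l) = \<eta>" using assms by (simp only: norm_of_real) simp
    moreover have "smult (of_real ?l) (r\<^sup>2 - y) = ?h\<^sup>2 + ?q\<^sup>2 - ?g\<^sup>2"
    proof -
      have "complex_of_real ?l * complex_of_real (1 / ?l) = 1"
        unfolding of_real_mult[symmetric] using assms by simp
      then have "smult (of_real ?l) y = ?g\<^sup>2 - ?h\<^sup>2" by (simp only: y_def smult_smult smult_1_left)
      moreover have "smult (of_real ?l) (r\<^sup>2) = ?q\<^sup>2"
        using assms by (simp add: power2_eq_square flip: of_real_mult)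
      ultimately show ?thesis by (simp add: smult_diff_right)
    qed
    ultimately have "bd (?h\<^sup>2 + ?q\<^sup>2 - ?g\<^sup>2) \<eta>" by metis
    then show "\<exists>q. pcnj q = q \<and> bd (?h\<^sup>2 + q\<^sup>2 - ?g\<^sup>2) \<eta>"
      using r(1) by (intro exI[of _ ?q]) simp
  qed
  then show ?thesis by (simp add: N_smult)
qed

end

section \<open>Powers in a triple\<close>

lemma pcnj_sum: "pcnj (\<Sum>i\<in>A. f i) = (\<Sum>i\<in>A. pcnj (f i))"
  by (induction A rule: infinite_finite_induct) simp_all

locale jb_triple =
  fixes J :: "'a::banach \<Rightarrow> 'a" and tp :: "'a \<Rightarrow> 'a \<Rightarrow> 'a \<Rightarrow> 'a"
  assumes jb: "JB_star_triple J tp"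
begin

lemmas jbD = jb[unfolded JB_star_triple_def]
lemmas complex_structure_J = jbD[THEN conjunct1, unfolded complex_structure_def]
lemmas linear_J = complex_structure_J[THEN conjunct1]
lemmas J_J [simp] = complex_structure_J[THEN conjunct2, THEN conjunct1, rule_format]
lemmas norm_J = complex_structure_J[THEN conjunct2, THEN conjunct2, rule_format]
lemmas linear_tp1 = jbD[THEN conjunct2, THEN conjunct1, rule_format]
lemmas linear_tp2 = jbD[THEN conjunct2, THEN conjunct2, THEN conjunct1, rule_format]
lemmas tp_commute = jbD[THEN conjunct2, THEN conjunct2, THEN conjunct2, THEN conjunct1, rule_format]
lemmas tp_J1 [simp] = jbD[THEN conjunct2, THEN conjunct2, THEN conjunct2, THEN conjunct2, THEN conjunct1, rule_format]
lemmas tp_J2 [simp] = jbD[THEN conjunct2, THEN conjunct2, THEN conjunct2, THEN conjunct2, THEN conjunct2, THEN conjunct1, rule_format]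
lemmas jordan = jbD[THEN conjunct2, THEN conjunct2, THEN conjunct2, THEN conjunct2, THEN conjunct2, THEN conjunct2, THEN conjunct2, THEN conjunct1, rule_format]
lemmas nonneg_spec = jbD[THEN conjunct2, THEN conjunct2, THEN conjunct2, THEN conjunct2, THEN conjunct2, THEN conjunct2, THEN conjunct2, THEN conjunct2, THEN conjunct1, rule_format, THEN conjunct2]
lemmas norm_cube = jbD[THEN conjunct2, THEN conjunct2, THEN conjunct2, THEN conjunct2, THEN conjunct2, THEN conjunct2, THEN conjunct2, THEN conjunct2, THEN conjunct2, rule_format]

lemma linear_tp3: "linear (\<lambda>z. tp x y z)"
  using linear_tp1[of y x] by (simp add: tp_commute[of x y])

lemma tp_J3 [simp]: "tp x y (J z) = J (tp x y z)"
  by (metis tp_J1 tp_commute)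

lemmas J_linear [simp] = linear_add[OF linear_J] linear_diff[OF linear_J] linear_neg[OF linear_J]
  linear_0[OF linear_J] linear_scale[OF linear_J]
lemmas tp_linear [simp] =
  linear_add[OF linear_tp1] linear_add[OF linear_tp2] linear_add[OF linear_tp3]
  linear_diff[OF linear_tp1] linear_diff[OF linear_tp2] linear_diff[OF linear_tp3]
  linear_neg[OF linear_tp1] linear_neg[OF linear_tp2] linear_neg[OF linear_tp3]
  linear_0[OF linear_tp1] linear_0[OF linear_tp2] linear_0[OF linear_tp3]
  linear_scale[OF linear_tp1] linear_scale[OF linear_tp2] linear_scale[OF linear_tp3]
lemmas tp_sum = linear_sum[OF linear_tp1] linear_sum[OF linear_tp2] linear_sum[OF linear_tp3]

lemma tp_bounded: obtains K where "0 \<le> K" "\<And>x y z. norm (tp x y z) \<le> K * norm x * norm y * norm z"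
proof -
  obtain K where K: "\<And>x y z. norm (tp x y z) \<le> K * norm x * norm y * norm z"
    using jbD[THEN conjunct2, THEN conjunct2, THEN conjunct2, THEN conjunct2, THEN conjunct2, THEN conjunct2, THEN conjunct1] by blast
  have "norm (tp x y z) \<le> max K 0 * norm x * norm y * norm z" for x y z
    using K[of x y z] by (elim order_trans) (intro mult_right_mono, auto)
  then show ?thesis using that[of "max K 0"] by simp
qed

abbreviation cs :: "complex \<Rightarrow> 'a \<Rightarrow> 'a" where "cs \<equiv> cscale J"

lemma cs_simps [simp]:
  "cs 0 x = 0" "cs 1 x = x" "cs c 0 = 0" "cs \<i> x = J x" "cs (- \<i>) x = - J x" "cs (-1) x = - x"
  "cs (of_real r) x = r *\<^sub>R x"
  by (simp_all add: cscale_def)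

lemma cs_add: "cs (c + d) x = cs c x + cs d x"
  and cs_add_right: "cs c (x + y) = cs c x + cs c y"
  and cs_cs: "cs c (cs d x) = cs (c * d) x"
  by (simp_all add: cscale_def algebra_simps)

lemma norm_cs [simp]: "norm (cs c x) = cmod c * norm x"
  by (simp add: cscale_def norm_J cmod_def)

lemma linear_cs: "linear (cs c)"
  by (rule linearI) (simp_all add: cscale_def algebra_simps)

lemma tp_cs:
  "tp (cs c x) y z = cs c (tp x y z)" "tp x (cs c y) z = cs (cnj c) (tp x y z)" "tp x y (cs c z) = cs c (tp x y z)"
  by (simp_all add: cscale_def)

end

text \<open>The relation lowers the middle index and raises an outer one, so a level is determined
  by its entries with middle index zero.\<close>

lemma signed_levels_vanish:
  fixes d :: "nat \<Rightarrow> nat \<Rightarrow> nat \<Rightarrow> 'a::ab_group_add"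
  assumes step: "\<And>i j k. i + j + k = n \<Longrightarrow> d i (Suc j) k = d (Suc i) j k + d i j (Suc k)"
    and zero: "\<And>i k. i + k = Suc n \<Longrightarrow> d i 0 k = 0"
  shows "i + j + k = Suc n \<Longrightarrow> d i j k = 0"
proof (induction j arbitrary: i k)
  case (Suc j)
  have "d i (Suc j) k = d (Suc i) j k + d i j (Suc k)" using Suc.prems by (intro step) simp
  also have "\<dots> = 0" using Suc.prems by (simp add: Suc.IH)
  finally show ?case .
qed (use zero in simp)

context jb_triple
begin

text \<open>The operator \<open>S\<close> supplies the one relation missing from the
recursion for the products \<open>tp (z i) (z 0) (z k)\<close>.\<close>

lemma powers_associate:
  fixes V S :: "'a \<Rightarrow> 'a" and z :: "nat \<Rightarrow> 'a"
  assumes V: "\<And>a b c. V (tp a b c) = tp (V a) b c - tp a (V b) c + tp a b (V c)"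
    and S: "\<And>a b c. S (tp a b c) = tp (S a) b c - tp a (S b) c + tp a b (S c)"
    and z: "\<And>i. z (Suc i) = V (z i)"
    and z0: "\<And>k. tp (z 0) (z 0) (z k) = z (k + s)"
    and S_eq: "(s = 1 \<and> (\<forall>k. S (z k) = tp (z 1) (z 0) (z k)))
       \<or> (s = 0 \<and> (\<forall>k. S (z k) = tp (z 1) (z 1) (z k)) \<and> (\<forall>k. tp (z 1) (z 0) (z k) = z (Suc k)))"
  shows "tp (z i) (z j) (z k) = z (i + j + k + s)"
proof -
  define d where "d i j k = tp (z i) (z j) (z k) - z (i + j + k + s)" for i j k
  have sym: "d i j k = d k j i" for i j k by (simp add: d_def tp_commute[of "z i"] add_ac)
  have "\<forall>i j k. i + j + k \<le> n \<longrightarrow> d i j k = 0" for n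
  proof (induction n)
    case 0
    then show ?case using z0[of 0] by (simp add: d_def)
  next
    case (Suc n)
    have IH: "tp (z i) (z j) (z k) = z (i + j + k + s)" if "i + j + k \<le> n" for i j k
      using Suc that by (simp add: d_def)
    \<comment> \<open>Applying the derivation \<open>V\<close> to a product of level
      \<open>n\<close>, which is already known, relates three defects of level
      \<open>n + 1\<close>.\<close>
    have step: "d i (Suc j) k = d (Suc i) j k + d i j (Suc k)" if "i + j + k = n" for i j k
    proof -
      have "z (Suc (n + s)) = tp (z (Suc i)) (z j) (z k) - tp (z i) (z (Suc j)) (z k) + tp (z i) (z j) (z (Suc k))"
        using V[of "z i" "z j" "z k"] IH[of i j k] that by (simp only: z[symmetric] order_refl)
      moreover have "i + Suc j + k + s = Suc (n + s)" "Suc i + j + k + s = Suc (n + s)" "i + j + Suc k + s = Suc (n + s)"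
        using that by auto
      ultimately show ?thesis by (simp only: d_def) (simp add: algebra_simps)
    qed
    have d00: "d 0 0 k = 0" for k using z0[of k] by (simp add: d_def)
    have zero: "d i 0 k = 0" if ik: "i + k = Suc n" for i k
    proof -
      consider "i = 0" | "k = 0" | i' k' where "i = Suc i'" "k = Suc k'" by (metis not0_implies_Suc)
      then show ?thesis
      proof cases
        case 3
        show ?thesis
        proof (cases "s = 1")
          case True
          with S_eq have S1: "S (z k) = tp (z 1) (z 0) (z k)" for k by simp
          have S2: "S (z l) = z (l + 2)" if "l < n" for l using IH[of 1 0 l] that True by (simp add: S1)
          \<comment> \<open>Here \<open>S\<close> raises indices by two. Its derivation rule gives a
            second relation between defects, and eliminating the middle index by \<open>step\<close>
            leaves only defects with middle index zero.\<close>
          have eq: "d (Suc a) 0 (Suc b) + d (Suc a) 0 (Suc b) = - d 1 0 n" if "a + b + 1 = n" for a b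
          proof -
            have "S (tp (z a) (z 0) (z b)) = tp (z (a + 2)) (z 0) (z b) - tp (z a) (z 2) (z b) + tp (z a) (z 0) (z (b + 2))"
              using that by (simp add: S S2 numeral_2_eq_2)
            moreover have "S (tp (z a) (z 0) (z b)) = tp (z 1) (z 0) (z n)"
              using IH[of a 0 b] that True by (simp add: S1)
            ultimately have 1: "d 1 0 n = d (a + 2) 0 b - d a 2 b + d a 0 (b + 2)"
              using that True by (simp add: d_def algebra_simps)
            have "d a 2 b = d (a + 1) 1 b + d a 1 (b + 1)" using step[of a 1 b] that by (simp add: numeral_2_eq_2)
            also have "d (a + 1) 1 b = d (a + 2) 0 b + d (a + 1) 0 (b + 1)" using step[of "a + 1" 0 b] that by simp
            also have "d a 1 (b + 1) = d (a + 1) 0 (b + 1) + d a 0 (b + 2)" using step[of a 0 "b + 1"] that by simp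
            finally have 2: "d a 2 b = d (a + 2) 0 b + d (a + 1) 0 (b + 1) + (d (a + 1) 0 (b + 1) + d a 0 (b + 2))" .
            show ?thesis unfolding 1 2 by simp
          qed
          have "n \<ge> 1" using ik 3 by simp
          \<comment> \<open>For \<open>a = 0\<close> the left side of \<open>eq\<close> is twice
            \<open>d 1 0 n\<close> itself.\<close>
          then have "d 1 0 n + d 1 0 n = - d 1 0 n" using eq[of 0 "n - 1"] by simp
          then have "3 *\<^sub>R d 1 0 n = 0" by (simp add: scaleR_2[symmetric] eq_neg_iff_add_eq_0 scaleR_left_distrib[of 2 1, simplified, symmetric])
          then have "d 1 0 n = 0" by simp
          then have "2 *\<^sub>R d i 0 k = 0" using eq[of i' k'] ik 3 by (simp add: scaleR_2)
          then show ?thesis by simp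
        next
          case False
          with S_eq have s: "s = 0" and S1: "\<And>k. S (z k) = tp (z 1) (z 1) (z k)"
            and z1: "\<And>k. tp (z 1) (z 0) (z k) = z (Suc k)" by auto
          have d1: "d 1 0 k = 0" for k using z1[of k] s by (simp add: d_def)
          \<comment> \<open>For \<open>s = 0\<close> the operator \<open>S\<close> itself has level
            two, so the induction hypothesis reaches only \<open>l + 2 \<le> n\<close>; therefore
            \<open>eq\<close> below takes \<open>a\<close> and \<open>b\<close> positive.\<close>
          have S2: "S (z l) = z (l + 2)" if "l + 2 \<le> n" for l using IH[of 1 1 l] that s by (simp add: S1)
          have eq: "d (Suc a) 0 (Suc b) + d (Suc a) 0 (Suc b) = - d 2 0 (n - 1)"
            if "a + b + 1 = n" "0 < a" "0 < b" for a b
          proof -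
            have "S (tp (z a) (z 0) (z b)) = tp (z (a + 2)) (z 0) (z b) - tp (z a) (z 2) (z b) + tp (z a) (z 0) (z (b + 2))"
              using that by (simp add: S S2 numeral_2_eq_2)
            moreover have "S (tp (z a) (z 0) (z b)) = tp (z 1) (z 1) (z (n - 1))"
              using IH[of a 0 b] that s by (auto simp: S1)
            ultimately have 1: "d 1 1 (n - 1) = d (a + 2) 0 b - d a 2 b + d a 0 (b + 2)"
              using that s by (auto simp: d_def algebra_simps)
            have "d a 2 b = d (a + 1) 1 b + d a 1 (b + 1)" using step[of a 1 b] that by (simp add: numeral_2_eq_2)
            also have "d (a + 1) 1 b = d (a + 2) 0 b + d (a + 1) 0 (b + 1)" using step[of "a + 1" 0 b] that by simp
            also have "d a 1 (b + 1) = d (a + 1) 0 (b + 1) + d a 0 (b + 2)" using step[of a 0 "b + 1"] that by simp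
            finally have 2: "d a 2 b = d (a + 2) 0 b + d (a + 1) 0 (b + 1) + (d (a + 1) 0 (b + 1) + d a 0 (b + 2))" .
            have 3: "d 2 0 (n - 1) = d 1 1 (n - 1)"
              using step[of 1 0 "n - 1"] that d1 by (auto simp: numeral_2_eq_2)
            show ?thesis unfolding 3 1 2 by simp
          qed
          have d2: "d 2 0 (n - 1) = 0"
          proof -
            consider "n = 1" | "n = 2" | "n \<ge> 3" using ik 3 by linarith
            then show ?thesis
            proof cases
              case 1 then show ?thesis using d00 sym[of 2 0 0] by simp
            next
              case 2 then show ?thesis using d1 sym[of 2 0 1] by simp
            next
              case 3
              \<comment> \<open>The choice \<open>a = 1\<close> makes both sides of
                \<open>eq\<close> multiples of \<open>d 2 0 (n - 1)\<close>.\<close>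
              then obtain m where "n = m + 3" by (metis le_add_diff_inverse2)
              then have "d 2 0 (n - 1) + d 2 0 (n - 1) = - d 2 0 (n - 1)"
                using eq[of 1 "m + 1"] by (simp add: numeral_2_eq_2)
              then have "3 *\<^sub>R d 2 0 (n - 1) = 0" by (simp add: scaleR_2[symmetric] eq_neg_iff_add_eq_0 scaleR_left_distrib[of 2 1, simplified, symmetric])
              then show ?thesis by simp
            qed
          qed
          show ?thesis
          proof (cases "i' = 0 \<or> k' = 0")
            case True
            then show ?thesis using d1 3 sym[of i 0 k] by auto
          next
            case False
            then have "2 *\<^sub>R d i 0 k = 0" using eq[of i' k'] ik 3 d2 by (simp add: scaleR_2)
            then show ?thesis by simp
          qed
        qed
      qed (use d00 sym[of i 0 k] in auto)
    qed
    show ?case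
    proof (intro allI impI)
      fix i j k assume "i + j + k \<le> Suc n"
      then consider "i + j + k \<le> n" | "i + j + k = Suc n" by linarith
      then show "d i j k = 0"
        by cases (use Suc signed_levels_vanish[of n d i j k] step zero in auto)
    qed
  qed
  then have "d i j k = 0" by blast
  then show ?thesis by (simp add: d_def)
qed

section \<open>Polynomial functional calculus\<close>

definition ev :: "(nat \<Rightarrow> 'a) \<Rightarrow> complex poly \<Rightarrow> 'a" where
  "ev z p = (\<Sum>i\<le>degree p. cs (coeff p i) (z i))"

lemma ev_altdef: "degree p \<le> n \<Longrightarrow> ev z p = (\<Sum>i\<le>n. cs (coeff p i) (z i))"
  unfolding ev_def by (rule sum.mono_neutral_left) (auto simp: coeff_eq_0)

lemma ev_0 [simp]: "ev z 0 = 0"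
  by (simp add: ev_def)

lemma ev_add: "ev z (p + q) = ev z p + ev z q"
  unfolding ev_altdef[OF degree_add_le_max] ev_altdef[of p "max (degree p) (degree q)" z, simplified]
    ev_altdef[of q "max (degree p) (degree q)" z, simplified]
  by (simp add: cs_add sum.distrib)

lemma ev_sum: "ev z (\<Sum>i\<in>A. f i) = (\<Sum>i\<in>A. ev z (f i))"
  by (induction A rule: infinite_finite_induct) (simp_all add: ev_add)

lemma ev_monom: "ev z (monom c n) = cs c (z n)"
  unfolding ev_altdef[OF degree_monom_le] by (simp add: if_distrib[of "\<lambda>c. cs c _"] cong: if_cong)

lemma ev_smult: "ev z (smult c p) = cs c (ev z p)"
  unfolding ev_altdef[OF degree_smult_le] by (simp add: ev_def linear_sum[OF linear_cs] cs_cs)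

lemma ev_pCons: "ev z [:a, b:] = cs a (z 0) + cs b (z 1)"
proof -
  have "[:a, b:] = monom a 0 + monom b 1" by (simp add: monom_0 monom_Suc)
  then show ?thesis by (simp only: ev_add ev_monom)
qed

lemma ev_shift:
  assumes "linear V" "\<And>x. V (J x) = J (V x)" "\<And>i. z (Suc i) = V (z i)"
  shows "ev z ([:0, 1:] * p) = V (ev z p)"
proof -
  have V: "V (cs c x) = cs c (V x)" for c x
    by (simp add: cscale_def assms(2) linear_add[OF assms(1)] linear_scale[OF assms(1)])
  have "ev z ([:0, 1:] * p) = ev z (\<Sum>i\<le>degree p. monom (coeff p i) (Suc i))"
    by (subst poly_as_sum_of_monoms[of p, symmetric]) (simp add: monom_Suc sum_distrib_left)
  also have "\<dots> = (\<Sum>i\<le>degree p. cs (coeff p i) (z (Suc i)))"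
    by (simp add: ev_sum ev_monom)
  also have "\<dots> = V (ev z p)"
    by (simp add: assms(3) V linear_sum[OF assms(1)] ev_def)
  finally show ?thesis .
qed

lemma ev_tp:
  assumes "\<And>i j k. tp (z i) (z j) (z k) = z (i + j + k + s)"
  shows "tp (ev z p) (ev z q) (ev z r) = ev z (p * pcnj q * r * monom 1 s)"
proof -
  let ?m = "\<lambda>p i. monom (coeff p i) i"
  have "p * pcnj q * r * monom 1 s
     = (\<Sum>i\<le>degree p. ?m p i) * pcnj (\<Sum>j\<le>degree q. ?m q j) * (\<Sum>k\<le>degree r. ?m r k) * monom 1 s"
    by (simp only: poly_as_sum_of_monoms)
  also have "pcnj (\<Sum>j\<le>degree q. ?m q j) = (\<Sum>j\<le>degree q. monom (cnj (coeff q j)) j)"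
    by (simp add: pcnj_sum)
  also have "(\<Sum>i\<le>degree p. ?m p i) * \<dots> * (\<Sum>k\<le>degree r. ?m r k) * monom 1 s
     = (\<Sum>k\<le>degree r. \<Sum>j\<le>degree q. \<Sum>i\<le>degree p. monom (coeff p i * cnj (coeff q j) * coeff r k) (i + j + k + s))"
    by (simp only: sum_product sum_distrib_left sum_distrib_right mult_monom mult_1_right)
  finally have "ev z (p * pcnj q * r * monom 1 s) =
      (\<Sum>k\<le>degree r. \<Sum>j\<le>degree q. \<Sum>i\<le>degree p. cs (coeff p i * cnj (coeff q j) * coeff r k) (z (i + j + k + s)))"
    by (simp only: ev_sum ev_monom)
  also have "\<dots> = tp (ev z p) (ev z q) (ev z r)"
    unfolding ev_def by (simp add: tp_sum tp_cs linear_sum[OF linear_cs] cs_cs assms mult_ac)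
  finally show ?thesis by simp
qed

text \<open>The triple product is bounded only up to a constant \<open>K\<close>. Cubing is
  multiplicative on these triple products, so iterating the cube identity and taking roots of order
  \<open>3 ^ k\<close> removes \<open>K\<close>.\<close>

lemma cubic_seminorm_ev:
  assumes "\<And>i j k. tp (z i) (z j) (z k) = z (i + j + k + s)"
  shows "cubic_seminorm (\<lambda>p. norm (ev z p)) s"
proof
  fix p q r
  let ?N = "\<lambda>p. norm (ev z p)"
  show "?N (p + q) \<le> ?N p + ?N q" by (simp add: ev_add norm_triangle_ineq)
  show "?N (smult c p) = cmod c * ?N p" for c by (simp add: ev_smult)
  show cube: "?N (p * pcnj p * p * monom 1 s) = ?N p ^ 3" for p
    using ev_tp[where z = z and s = s, OF assms, of p p p] norm_cube[of "ev z p"] by simp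
  obtain K where K: "0 \<le> K" "\<And>x y z. norm (tp x y z) \<le> K * norm x * norm y * norm z" by (rule tp_bounded) blast
  have "\<forall>p q r. ?N (p * pcnj q * r * monom 1 s) ^ (3 ^ k) \<le> K * (?N p * ?N q * ?N r) ^ (3 ^ k)" for k :: nat
  proof (induction k)
    case 0
    show ?case
    proof (intro allI)
      fix p q r
      show "?N (p * pcnj q * r * monom 1 s) ^ 3 ^ 0 \<le> K * (?N p * ?N q * ?N r) ^ 3 ^ 0"
        using K(2)[of "ev z p" "ev z q" "ev z r"] unfolding ev_tp[where z = z and s = s, OF assms] by (simp add: mult.assoc)
    qed
  next
    case (Suc k)
    show ?case
    proof (intro allI)
      fix p q r
      let ?c = "\<lambda>p. p * pcnj p * p * monom 1 s"
      have "?N (p * pcnj q * r * monom 1 s) ^ (3 ^ Suc k) = ?N (?c (p * pcnj q * r * monom 1 s)) ^ (3 ^ k)"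
        by (simp only: cube power_Suc power_mult)
      also have "?c (p * pcnj q * r * monom 1 s) = ?c p * pcnj (?c q) * ?c r * monom 1 s"
        by (rule poly_ext) (simp add: poly_monom mult_ac)
      also have "?N (?c p * pcnj (?c q) * ?c r * monom 1 s) ^ (3 ^ k) \<le> K * (?N (?c p) * ?N (?c q) * ?N (?c r)) ^ (3 ^ k)"
        using Suc by blast
      also have "\<dots> = K * (?N p * ?N q * ?N r) ^ (3 ^ Suc k)"
        by (simp only: cube power_mult_distrib[symmetric] power_Suc power_mult)
      finally show "?N (p * pcnj q * r * monom 1 s) ^ (3 ^ Suc k) \<le> K * (?N p * ?N q * ?N r) ^ (3 ^ Suc k)" .
    qed
  qed
  then have powers: "?N (p * pcnj q * r * monom 1 s) ^ (3 ^ k) \<le> K * (?N p * ?N q * ?N r) ^ (3 ^ k)" for k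
    by blast
  show "?N (p * pcnj q * r * monom 1 s) \<le> ?N p * ?N q * ?N r"
    by (rule le_if_powers_le[OF _ _ powers]) simp_all
qed

end

section \<open>Functional calculus for one element\<close>

text \<open>The bounded inverse theorem. Baire category gives approximate preimages of controlled
  norm; the residuals halve, so the corrections sum to an exact preimage.\<close>

lemma bounded_below_if_bij:
  fixes T :: "'a::banach \<Rightarrow> 'a"
  assumes T: "bounded_linear T" "bij T"
  shows "\<exists>C. \<forall>x. norm x \<le> C * norm (T x)"
proof -
  interpret T: bounded_linear T by fact
  let ?B = "\<lambda>n::nat. closure (T ` cball 0 (real n))"
  have "\<exists>n. interior (?B n) \<noteq> {}"
  proof (rule ccontr)
    assume "\<not> ?thesis"
    then have "euclidean interior_of \<Union>(range ?B) = {}"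
      by (intro Baire_category_alt) (auto simp: completely_metrizable_space_euclidean)
    moreover have "\<Union>(range ?B) = UNIV"
    proof -
      have "y \<in> \<Union>(range ?B)" for y
      proof -
        obtain x where x: "y = T x" using T(2) by (metis bij_pointE)
        obtain n :: nat where "norm x \<le> real n" using real_arch_simple by blast
        with x have "y \<in> ?B n" using closure_subset by (force simp: dist_norm)
        then show ?thesis by blast
      qed
      then show ?thesis by blast
    qed
    ultimately show False by simp
  qed
  then obtain n y0 r where r: "0 < r" "ball y0 r \<subseteq> ?B n"
    by (metis all_not_in_conv mem_interior)
  \<comment> \<open>Subtract approximate preimages of \<open>y0 + y\<close> and \<open>y0\<close>,
    which both lie in the closed image.\<close>
  have approx0: "\<exists>x. norm x \<le> 2 * real n \<and> norm (y - T x) \<le> \<delta>" if y: "norm y < r" and \<delta>: "0 < \<delta>" for y \<delta>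
  proof -
    have "y0 \<in> ?B n" "y0 + y \<in> ?B n" using r y by (auto simp: subset_iff dist_norm)
    then have "\<exists>a\<in>T ` cball 0 (real n). dist a y0 < \<delta> / 2" "\<exists>b\<in>T ` cball 0 (real n). dist b (y0 + y) < \<delta> / 2"
      unfolding closure_approachable using \<delta> half_gt_zero by blast+
    then obtain a b where ab: "norm a \<le> n" "norm (T a - y0) < \<delta> / 2" "norm b \<le> n" "norm (T b - (y0 + y)) < \<delta> / 2"
      by (auto simp: dist_norm)
    have "norm (y - T (b - a)) = norm ((T a - y0) - (T b - (y0 + y)))"
      by (simp add: T.diff algebra_simps)
    also have "\<dots> \<le> norm (T a - y0) + norm (T b - (y0 + y))" by (rule norm_triangle_ineq4)
    finally have "norm (y - T (b - a)) \<le> \<delta>" using ab by simp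
    moreover have "norm (b - a) \<le> 2 * real n" using norm_triangle_ineq4[of b a] ab by simp
    ultimately show ?thesis by blast
  qed
  define M where "M = 4 * real n / r"
  have M: "0 \<le> M" using r by (simp add: M_def)
  have approx: "\<exists>x. norm x \<le> M * norm y \<and> norm (y - T x) \<le> norm y / 2" for y
  proof (cases "y = 0")
    case False
    \<comment> \<open>The scaled vector has norm \<open>r / 2\<close>, so it lies where
      \<open>approx0\<close> applies.\<close>
    define c where "c = r / (2 * norm y)"
    have c: "0 < c" using False r by (simp add: c_def)
    have "norm (c *\<^sub>R y) < r" using False r by (simp add: c_def)
    moreover have "0 < c * norm y / 2" using c False by simp
    ultimately obtain x where x: "norm x \<le> 2 * real n" "norm (c *\<^sub>R y - T x) \<le> c * norm y / 2"
      using approx0 by blast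
    have "norm (y - T ((1 / c) *\<^sub>R x)) = norm ((1 / c) *\<^sub>R (c *\<^sub>R y - T x))"
      using c by (simp add: T.scaleR scaleR_diff_right)
    also have "\<dots> = norm (c *\<^sub>R y - T x) / c" using c by (simp only: norm_scaleR) simp
    also have "\<dots> \<le> norm y / 2" using x(2) c by (simp add: field_simps)
    finally have "norm (y - T ((1 / c) *\<^sub>R x)) \<le> norm y / 2" .
    moreover have "norm ((1 / c) *\<^sub>R x) \<le> M * norm y"
      using x(1) c r False by (simp add: M_def c_def field_simps)
    ultimately show ?thesis by blast
  qed (auto simp: T.zero intro!: exI[of _ 0])
  then obtain h where h: "\<And>y. norm (h y) \<le> M * norm y" "\<And>y. norm (y - T (h y)) \<le> norm y / 2" by metis
  have "norm v \<le> 2 * M * norm (T v)" for v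
  proof -
    define w where "w = rec_nat (T v) (\<lambda>_ y. y - T (h y))"
    have w: "w 0 = T v" "\<And>k. w (Suc k) = w k - T (h (w k))" by (simp_all add: w_def)
    have wn: "norm (w k) \<le> norm (T v) * (1/2) ^ k" for k
    proof (induction k)
      case (Suc k)
      then show ?case using h(2)[of "w k"] by (simp add: w)
    qed (simp add: w)
    have hw: "norm (h (w k)) \<le> M * norm (T v) * (1/2) ^ k" for k
      using h(1)[of "w k"] mult_left_mono[OF wn[of k] M] by (simp add: mult.assoc)
    have geo: "(\<lambda>k. M * norm (T v) * (1/2) ^ k) sums (M * norm (T v) * 2)"
      using sums_mult[OF geometric_sums[of "1/2::real"], of "M * norm (T v)"] by simp
    have sm: "summable (\<lambda>k. norm (h (w k)))"
      by (rule summable_comparison_test'[OF sums_summable[OF geo], of 0]) (simp only: real_norm_def abs_norm_cancel hw)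
    define x where "x = (\<Sum>k. h (w k))"
    have xs: "(\<lambda>k. h (w k)) sums x" unfolding x_def by (rule summable_sums[OF summable_norm_cancel[OF sm]])
    have "norm x \<le> (\<Sum>k. norm (h (w k)))" unfolding x_def by (rule summable_norm[OF sm])
    also have "\<dots> \<le> M * norm (T v) * 2"
      unfolding sums_unique[OF geo] by (intro suminf_le hw sm sums_summable[OF geo])
    finally have nx: "norm x \<le> 2 * M * norm (T v)" by simp
    have "(\<Sum>k<m. T (h (w k))) = T v - w m" for m
      by (induction m) (simp_all add: w)
    moreover have "(\<lambda>m. T v - w m) \<longlonglongrightarrow> T v - 0"
    proof (intro tendsto_diff tendsto_const)
      show "w \<longlonglongrightarrow> 0"
      proof (rule Lim_null_comparison)
        show "\<forall>\<^sub>F k in sequentially. norm (w k) \<le> norm (T v) * (1/2) ^ k" using wn by simp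
        show "(\<lambda>k. norm (T v) * (1/2) ^ k) \<longlonglongrightarrow> 0"
          by (intro tendsto_mult_right_zero LIMSEQ_power_zero) simp
      qed
    qed
    ultimately have "(\<lambda>k. T (h (w k))) sums T v" by (simp add: sums_def)
    then have "T x = T v" using T.sums[OF xs] sums_unique2 by blast
    then have "x = v" using T(2) by (simp add: bij_def inj_eq)
    with nx show ?thesis by simp
  qed
  then show ?thesis by blast
qed

context jb_triple
begin

lemma bounded_linear_tp: "bounded_linear (tp x y)"
proof -
  obtain K where K: "0 \<le> K" "\<And>x y z. norm (tp x y z) \<le> K * norm x * norm y * norm z" by (rule tp_bounded) blast
  show ?thesis
    by (intro bounded_linear_intro[where K = "K * norm x * norm y"]) (use K(2)[of x y] in \<open>auto simp: mult_ac\<close>)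
qed

text \<open>The number \<open>- \<epsilon>\<close> lies outside the non-negative half-line, so the
  spectral axiom gives bijectivity.\<close>

lemma tp_self_bounded_below:
  assumes "0 < \<epsilon>"
  shows "\<exists>C. \<forall>v. norm v \<le> C * norm (tp x x v + \<epsilon> *\<^sub>R v)"
proof (rule bounded_below_if_bij)
  show "bounded_linear (\<lambda>v. tp x x v + \<epsilon> *\<^sub>R v)"
    by (intro bounded_linear_add bounded_linear_tp bounded_linear_scaleR_right)
  have "bij (\<lambda>v. tp x x v - cs (of_real (- \<epsilon>)) v)"
    using nonneg_spec[of x] assms unfolding nonneg_spectrum_def by (metis Re_complex_of_real neg_0_le_iff_le not_le)
  then show "bij (\<lambda>v. tp x x v + \<epsilon> *\<^sub>R v)" by (simp only: cs_simps) simp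
qed

definition odd_power :: "'a \<Rightarrow> nat \<Rightarrow> 'a" where
  "odd_power x n = (tp x x ^^ n) x"

lemma odd_power_0 [simp]: "odd_power x 0 = x" and odd_power_Suc: "odd_power x (Suc n) = tp x x (odd_power x n)"
  by (simp_all add: odd_power_def)

text \<open>In this instance of the Jordan identity the outer terms cancel. The symmetry is what
  makes \<open>tp (tp x x x) x\<close> satisfy the derivation rule that
  \<open>powers_associate\<close> expects of \<open>S\<close>.\<close>

lemma tp_cube_swap: "tp (tp x x x) x y = tp x (tp x x x) y"
  using jordan[of x x x x y] by simp

lemma tp_odd_power: "tp (odd_power x i) (odd_power x j) (odd_power x k) = odd_power x (i + j + k + 1)"
proof (rule powers_associate[where V = "tp x x" and S = "tp (tp x x x) x"])
  show "tp (tp x x x) x (tp a b c) = tp (tp (tp x x x) x a) b c - tp a (tp (tp x x x) x b) c + tp a b (tp (tp x x x) x c)" for a b c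
    using jordan[of "tp x x x" x a b c] by (simp add: tp_cube_swap)
  show "tp x x (tp a b c) = tp (tp x x a) b c - tp a (tp x x b) c + tp a b (tp x x c)" for a b c
    by (rule jordan)
qed (simp_all add: odd_power_Suc)

lemma positive_cubic_seminorm_odd_power:
  assumes "norm x \<le> 1"
  shows "positive_cubic_seminorm (\<lambda>p. norm (ev (odd_power x) p))"
proof -
  interpret cubic_seminorm "\<lambda>p. norm (ev (odd_power x) p)" 1
    by (rule cubic_seminorm_ev) (rule tp_odd_power)
  have ev1: "ev (odd_power x) 1 = x" using ev_monom[of "odd_power x" 1 0] by simp
  have shift: "ev (odd_power x) ([:0, 1:] * p) = tp x x (ev (odd_power x) p)" for p
    by (rule ev_shift) (simp_all add: linear_tp3 odd_power_Suc)
  have X: "bd [:0, 1:] 1"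
    unfolding bd_def
  proof
    fix f
    have "norm (ev (odd_power x) ([:0, 1:] * f)) = norm (ev (odd_power x) (1 * pcnj 1 * f * monom 1 1))"
      by (simp add: monom_Suc)
    also have "\<dots> \<le> norm (ev (odd_power x) 1) * norm (ev (odd_power x) 1) * norm (ev (odd_power x) f)" by (rule N_triple)
    also have "\<dots> \<le> 1 * norm (ev (odd_power x) f)"
      unfolding ev1 by (intro mult_right_mono) (use assms in \<open>auto simp: mult_le_one\<close>)
    finally show "norm (ev (odd_power x) ([:0, 1:] * f)) \<le> 1 * norm (ev (odd_power x) f)" .
  qed
  have "bd (1 - [:0, 1:]) 1"
  proof (rule positive_if_bounded_below[OF X])
    fix \<epsilon> :: real assume "0 < \<epsilon>"
    then obtain C where C: "\<And>v. norm v \<le> C * norm (tp x x v + \<epsilon> *\<^sub>R v)"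
      using tp_self_bounded_below by blast
    have "ev (odd_power x) ([:of_real \<epsilon>, 1:] * f) = tp x x (ev (odd_power x) f) + \<epsilon> *\<^sub>R ev (odd_power x) f" for f
    proof -
      have "[:of_real \<epsilon>, 1:] * f = [:0, 1:] * f + smult (of_real \<epsilon>) f" by (rule poly_ext) (simp add: algebra_simps)
      then show ?thesis by (simp only: ev_add shift ev_smult cs_simps)
    qed
    then show "\<exists>C. \<forall>f. norm (ev (odd_power x) f) \<le> C * norm (ev (odd_power x) ([:of_real \<epsilon>, 1:] * f))"
      using C by auto
  qed
  then show ?thesis by unfold_locales (rule X)
qed

lemma norm_three_halves_le:
  assumes "norm x \<le> 1"
  shows "norm ((3/2) *\<^sub>R x - (1/2) *\<^sub>R tp x x x) \<le> 1"
proof -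
  interpret positive_cubic_seminorm "\<lambda>p. norm (ev (odd_power x) p)"
    by (rule positive_cubic_seminorm_odd_power) fact
  have "ev (odd_power x) [:of_real (3/2), of_real (-1/2):] = (3/2) *\<^sub>R x - (1/2) *\<^sub>R tp x x x"
    by (simp only: ev_pCons cs_simps) (simp add: odd_power_Suc)
  then show ?thesis using N_three_halves by simp
qed

lemma norm_diff_cube_le:
  assumes "norm x \<le> 1" "0 < c"
  shows "sqrt (c\<^sup>2 + 1) * norm (x - tp x x x) \<le> norm (x + c *\<^sub>R (x - tp x x x))"
proof -
  interpret positive_cubic_seminorm "\<lambda>p. norm (ev (odd_power x) p)"
    by (rule positive_cubic_seminorm_odd_power) fact
  have R: "ev (odd_power x) (1 - [:0, 1:]) = x - tp x x x"
  proof -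
    have "1 - [:0, 1:] = [:1, -1::complex:]" by (rule poly_ext) simp
    then show ?thesis by (simp only: ev_pCons cs_simps) (simp add: odd_power_Suc)
  qed
  moreover have "ev (odd_power x) (1 + smult (of_real c) (1 - [:0, 1:])) = x + c *\<^sub>R (x - tp x x x)"
    using ev_monom[of "odd_power x" 1 0] by (simp only: ev_add ev_smult R cs_simps) simp
  ultimately show ?thesis using N_one_minus_X_le[OF assms(2)] by simp
qed

end

section \<open>Peirce decomposition of a tripotent\<close>

text \<open>The method \<open>norm\<close> decides linear identities between vectors but does not use equations as
premises, so the combination of the premises has to be given.\<close>

lemma lin_comb1:
  fixes v w :: "'a::real_vector"
  assumes "l = r" "v - w = a *\<^sub>R (l - r)"
  shows "v = w"
  using assms by simp

lemma lin_comb2: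
  fixes v w :: "'a::real_vector"
  assumes "l = r" "l' = r'" "v - w = a *\<^sub>R (l - r) + b *\<^sub>R (l' - r')"
  shows "v = w"
  using assms by simp

context jb_triple
begin

text \<open>Iterated cubes remove the constant \<open>C\<close>. The set \<open>A\<close> allows
  maps that respect cubes only on a subspace, as \<open>Q\<close> does on the Peirce-2
  space.\<close>

lemma cube_hom_contractive:
  assumes cubes: "\<And>x. x \<in> A \<Longrightarrow> tp x x x \<in> A"
    and hom: "\<And>x. x \<in> A \<Longrightarrow> H (tp x x x) = tp (H x) (H x) (H x)"
    and bound: "\<And>x. x \<in> A \<Longrightarrow> norm (H x) \<le> C * norm x"
    and "x \<in> A"
  shows "norm (H x) \<le> norm x"
proof -
  have "norm (H y) ^ (3 ^ k) \<le> C * norm y ^ (3 ^ k)" if "y \<in> A" for k :: nat and y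
    using that
  proof (induction k arbitrary: y)
    case (Suc k)
    have "norm (H y) ^ (3 ^ Suc k) = norm (H (tp y y y)) ^ (3 ^ k)"
      by (simp only: hom[OF Suc.prems] norm_cube power_Suc power_mult)
    also have "\<dots> \<le> C * norm (tp y y y) ^ (3 ^ k)" by (intro Suc.IH cubes Suc.prems)
    also have "\<dots> = C * norm y ^ (3 ^ Suc k)" by (simp only: norm_cube power_Suc power_mult)
    finally show ?case .
  qed (simp add: bound)
  from this[OF \<open>x \<in> A\<close>] show ?thesis by (rule le_if_powers_le[rotated 2]) auto
qed

lemma bounded_linear_cs: "bounded_linear (cs c)"
  by (intro bounded_linear_intro[where K = "cmod c"])
    (simp_all add: cs_add_right linear_scale[OF linear_cs] mult.commute)

end

locale tripotent_element = jb_triple +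
  fixes u assumes tripotent_u: "tp u u u = u"
begin

abbreviation L :: "'a \<Rightarrow> 'a" where "L x \<equiv> tp u u x"
abbreviation Q :: "'a \<Rightarrow> 'a" where "Q x \<equiv> tp u x u"

text \<open>Two instances of the Jordan identity give \<open>LQ + QL = 2 Q\<close> and
  \<open>2 LQ - QL = Q\<close>, a linear system with the solution
  \<open>LQ = QL = Q\<close>.\<close>

lemma LQ: "L (Q x) = Q x" and QL: "Q (L x) = Q x"
proof -
  have 1: "L (Q x) = Q x - Q (L x) + Q x"
    using jordan[of u u u x u] by (simp add: tripotent_u)
  have 2: "Q x = L (Q x) - Q (L x) + L (Q x)"
    using jordan[of u x u u u] by (simp add: tripotent_u tp_commute[of x u u] tp_commute[of "Q x" u u])
  show "L (Q x) = Q x" by (rule lin_comb2[OF 1 2, where a = "1/3" and b = "-1/3"]) norm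
  show "Q (L x) = Q x" by (rule lin_comb2[OF 1 2, where a = "2/3" and b = "1/3"]) norm
qed

lemma QQ: "Q (Q x) = 2 *\<^sub>R L (L x) - L x"
proof -
  have 1: "L x = L (L x) - Q (Q x) + L (L x)"
    using jordan[of x u u u u] by (simp add: tripotent_u tp_commute[of x u u] tp_commute[of "L x" u u])
  show ?thesis by (rule lin_comb1[OF 1, where a = 1]) norm
qed

text \<open>Comparing \<open>QQ\<close> at \<open>x\<close> and at \<open>L x\<close>, which
  \<open>Q\<close> does not distinguish, yields the polynomial
  \<open>2 t\<^sup>3 - 3 t\<^sup>2 + t\<close> with roots \<open>0\<close>, \<open>1/2\<close> and
  \<open>1\<close>.\<close>

lemma LLL: "L (L (L x)) = (3/2) *\<^sub>R L (L x) - (1/2) *\<^sub>R L x"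
proof -
  have 1: "2 *\<^sub>R L (L (L x)) - L (L x) = 2 *\<^sub>R L (L x) - L x"
    using QQ[of "L x"] QQ[of x] by (simp add: QL)
  show ?thesis by (rule lin_comb1[OF 1, where a = "1/2"]) norm
qed

text \<open>The Lagrange interpolation polynomials of \<open>L\<close> at \<open>0\<close>,
  \<open>1/2\<close> and \<open>1\<close>, that is, the projections onto the eigenspaces for
  \<open>k / 2\<close>.\<close>

definition peirce :: "nat \<Rightarrow> 'a \<Rightarrow> 'a" where
  "peirce k x = (if k = 0 then x - 3 *\<^sub>R L x + 2 *\<^sub>R L (L x)
    else if k = 1 then 4 *\<^sub>R L x - 4 *\<^sub>R L (L x) else 2 *\<^sub>R L (L x) - L x)"

lemma peirce_sum: "(\<Sum>k<3. peirce k x) = x"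
proof -
  have "(\<Sum>k<3. peirce k x) = peirce 0 x + peirce 1 x + peirce 2 x" by (simp add: eval_nat_numeral)
  also have "\<dots> = x" unfolding peirce_def by simp norm
  finally show ?thesis .
qed

lemma L_peirce: "k < 3 \<Longrightarrow> L (peirce k x) = (of_nat k / 2) *\<^sub>R peirce k x"
proof -
  assume "k < 3"
  then consider "k = 0" | "k = 1" | "k = 2" by linarith
  then show ?thesis
  proof cases
    case 1 then show ?thesis by (simp add: peirce_def LLL) norm
  next
    case 2 then show ?thesis by (simp add: peirce_def LLL) norm
  next
    case 3 then show ?thesis by (simp add: peirce_def LLL) norm
  qed
qed

lemma eigenvalue_cases:
  assumes "L x = a *\<^sub>R x"
  shows "x = 0 \<or> a = 0 \<or> a = 1/2 \<or> a = 1"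
proof -
  have "(a * (a * a)) *\<^sub>R x = ((3/2) * (a * a) - (1/2) * a) *\<^sub>R x"
    using LLL[of x] by (simp add: assms scaleR_diff_left mult.assoc)
  then have "x = 0 \<or> a * (a * a) = (3/2) * (a * a) - (1/2) * a" by (simp only: scaleR_cancel_right) blast
  moreover have "a * ((a - 1/2) * (a - 1)) = a * (a * a) - ((3/2) * (a * a) - (1/2) * a)"
    by (simp add: field_simps)
  ultimately have "x = 0 \<or> a * ((a - 1/2) * (a - 1)) = 0" by auto
  then show ?thesis by auto
qed

lemma peirce_rule:
  assumes "L x = a *\<^sub>R x" "L y = b *\<^sub>R y" "L z = c *\<^sub>R z"
  shows "L (tp x y z) = (a - b + c) *\<^sub>R tp x y z"
  by (simp add: jordan[of u u x y z] assms algebra_simps)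

lemma peirce_rule_zero:
  assumes "L x = a *\<^sub>R x" "L y = b *\<^sub>R y" "L z = c *\<^sub>R z" "a - b + c < 0 \<or> 1 < a - b + c"
  shows "tp x y z = 0"
  using eigenvalue_cases[OF peirce_rule[OF assms(1-3)]] assms(4) by auto

text \<open>The one-parameter group \<open>exp (2 i \<theta> L)\<close> of isometries.\<close>

definition rot :: "real \<Rightarrow> 'a \<Rightarrow> 'a" where
  "rot \<theta> x = (\<Sum>k<3. cs (cis (of_nat k * \<theta>)) (peirce k x))"

lemma linear_peirce: "linear (peirce k)"
  unfolding peirce_def by (rule linearI) (simp_all add: algebra_simps)

lemma linear_rot: "linear (rot \<theta>)"
proof (rule linearI)
  show "rot \<theta> (x + y) = rot \<theta> x + rot \<theta> y" for x y
    by (simp add: rot_def linear_add[OF linear_peirce] cs_add_right sum.distrib)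
  show "rot \<theta> (r *\<^sub>R x) = r *\<^sub>R rot \<theta> x" for r x
    by (simp add: rot_def linear_scale[OF linear_peirce] linear_scale[OF linear_cs] scaleR_right.sum)
qed

lemma rot_eigen:
  assumes "L x = a *\<^sub>R x"
  shows "rot \<theta> x = cs (cis (2 * a * \<theta>)) x"
proof -
  have "rot \<theta> x = peirce 0 x + cs (cis \<theta>) (peirce 1 x) + cs (cis (2 * \<theta>)) (peirce 2 x)"
    by (simp add: rot_def eval_nat_numeral)
  moreover consider "x = 0" | "a = 0" | "a = 1/2" | "a = 1" using eigenvalue_cases[OF assms] by blast
  then have "peirce 0 x + cs (cis \<theta>) (peirce 1 x) + cs (cis (2 * \<theta>)) (peirce 2 x) = cs (cis (2 * a * \<theta>)) x"
  proof cases
    case 3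
    have "peirce 0 x = 0" by (simp add: peirce_def assms 3) norm
    moreover have "peirce 1 x = x" by (simp add: peirce_def assms 3) norm
    moreover have "peirce 2 x = 0" by (simp add: peirce_def assms 3)
    ultimately show ?thesis by (simp add: 3)
  next
    case 4
    have "peirce 0 x = 0" by (simp add: peirce_def assms 4) norm
    moreover have "peirce 1 x = 0" by (simp add: peirce_def assms 4)
    moreover have "peirce 2 x = x" by (simp add: peirce_def assms 4) norm
    ultimately show ?thesis by (simp add: 4)
  qed (simp_all add: peirce_def assms)
  ultimately show ?thesis by simp
qed

text \<open>On Peirce components the phases \<open>i\<close>, \<open>- j\<close>, \<open>k\<close>
  of the factors add up to that of the product, by the Peirce rule.\<close>

lemma rot_tp: "rot \<theta> (tp x x x) = tp (rot \<theta> x) (rot \<theta> x) (rot \<theta> x)"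
proof -
  have "rot \<theta> (tp (peirce i x) (peirce j x) (peirce k x))
      = tp (cs (cis (of_nat i * \<theta>)) (peirce i x)) (cs (cis (of_nat j * \<theta>)) (peirce j x)) (cs (cis (of_nat k * \<theta>)) (peirce k x))"
    if "i < 3" "j < 3" "k < 3" for i j k
    using rot_eigen[OF peirce_rule[OF L_peirce[OF that(1)] L_peirce[OF that(2)] L_peirce[OF that(3)]], of \<theta> x x x]
    by (simp add: tp_cs cs_cs cis_cnj cis_mult algebra_simps)
  then have "(\<Sum>k<3. \<Sum>j<3. \<Sum>i<3. rot \<theta> (tp (peirce i x) (peirce j x) (peirce k x))) = tp (rot \<theta> x) (rot \<theta> x) (rot \<theta> x)"
    by (simp add: rot_def[of \<theta> x] tp_sum)
  moreover have "(\<Sum>k<3. \<Sum>j<3. \<Sum>i<3. rot \<theta> (tp (peirce i x) (peirce j x) (peirce k x)))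
      = rot \<theta> (tp (\<Sum>i<3. peirce i x) (\<Sum>i<3. peirce i x) (\<Sum>i<3. peirce i x))"
    by (simp only: tp_sum linear_sum[OF linear_rot])
  ultimately show ?thesis by (simp only: peirce_sum)
qed

lemma norm_rot_le: "norm (rot \<theta> x) \<le> norm x"
proof -
  have L: "bounded_linear (\<lambda>x. L (L x))" "bounded_linear (\<lambda>x. L x)"
    using bounded_linear_compose[OF bounded_linear_tp bounded_linear_tp] bounded_linear_tp by auto
  have R: "bounded_linear (\<lambda>x. r *\<^sub>R f x)" if "bounded_linear f" for r and f :: "'a \<Rightarrow> 'a"
    by (rule bounded_linear_compose[OF bounded_linear_scaleR_right that])
  have "bounded_linear (peirce k)" for k
    by (cases "k = 0"; cases "k = 1")
      (simp_all add: peirce_def[abs_def] bounded_linear_add bounded_linear_sub bounded_linear_ident R L)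
  then have "bounded_linear (rot \<theta>)"
    unfolding rot_def by (intro bounded_linear_sum bounded_linear_compose[OF bounded_linear_cs]) auto
  then obtain C where C: "\<And>x. norm (rot \<theta> x) \<le> norm x * C" using bounded_linear.bounded by blast
  show ?thesis
    by (rule cube_hom_contractive[where A = UNIV and C = C]) (use C rot_tp in \<open>auto simp: mult.commute\<close>)
qed

lemma rot_eq: "rot \<theta> x = peirce 0 x + cs (cis \<theta>) (peirce 1 x) + cs (cis (2 * \<theta>)) (peirce 2 x)"
  by (simp add: rot_def eval_nat_numeral)

lemma rot_quarter: "rot (pi/2) x = peirce 0 x + J (peirce 1 x) - peirce 2 x"
  "rot (- (pi/2)) x = peirce 0 x - J (peirce 1 x) - peirce 2 x" "rot pi x = peirce 0 x - peirce 1 x + peirce 2 x"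
  by (simp_all add: rot_eq cis_pi_half cis.ctr cscale_def)

lemma x_eq_peirce: "x = peirce 0 x + peirce 1 x + peirce 2 x"
  using peirce_sum[of x] by (simp add: eval_nat_numeral)

declare One_nat_def [simp del]

text \<open>A Fourier average of four contractions: the weights \<open>1, -1, -1, 1\<close> at the
  angles \<open>0\<close>, \<open>pi/2\<close>, \<open>-pi/2\<close>, \<open>pi\<close> cancel the
  components of index \<open>0\<close> and \<open>1\<close>.\<close>

lemma norm_pp2_le: "norm (peirce 2 x) \<le> norm x"
proof -
  have "x - rot (pi/2) x - rot (- (pi/2)) x + rot pi x = 4 *\<^sub>R peirce 2 x"
    by (subst (1) x_eq_peirce[of x]) (simp only: rot_quarter, norm)
  moreover have "norm (x - rot (pi/2) x - rot (- (pi/2)) x + rot pi x)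
      \<le> norm x + norm (rot (pi/2) x) + norm (rot (- (pi/2)) x) + norm (rot pi x)"
    by norm
  ultimately show ?thesis
    using norm_rot_le[of "pi/2" x] norm_rot_le[of "- (pi/2)" x] norm_rot_le[of pi x] by simp
qed

text \<open>A Fejer-type mean: it removes the Peirce-0 part but keeps half of the Peirce-1 part,
  which makes that part accessible to norm estimates.\<close>

lemma norm_fejer_le: "norm (peirce 2 x + (1/2) *\<^sub>R peirce 1 x) \<le> norm x"
proof -
  have "(x - rot (pi/2) x) + (x - rot (- (pi/2)) x) = 4 *\<^sub>R (peirce 2 x + (1/2) *\<^sub>R peirce 1 x)"
    by (subst (1 3) x_eq_peirce[of x]) (simp only: rot_quarter, norm)
  then have "norm (4 *\<^sub>R (peirce 2 x + (1/2) *\<^sub>R peirce 1 x)) = norm ((x - rot (pi/2) x) + (x - rot (- (pi/2)) x))" by simp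
  also have "\<dots> \<le> norm x + norm (rot (pi/2) x) + (norm x + norm (rot (- (pi/2)) x))"
    by (intro order_trans[OF norm_triangle_ineq] add_mono norm_triangle_ineq4)
  also have "\<dots> \<le> 4 * norm x"
    using norm_rot_le[of "pi/2" x] norm_rot_le[of "- (pi/2)" x] by simp
  finally show ?thesis by (simp only: norm_scaleR)
qed

lemma norm_u_le_1: "norm u \<le> 1"
proof (rule ccontr)
  assume "\<not> norm u \<le> 1"
  then have "norm u ^ 1 < norm u ^ 3" by (intro power_strict_increasing) auto
  then show False using norm_cube[of u] by (simp add: tripotent_u)
qed

lemma norm_add_half_le: "norm (u + x) \<le> 1 \<Longrightarrow> norm (u + (1/2) *\<^sub>R x) \<le> 1"
proof -
  assume "norm (u + x) \<le> 1"
  have "norm (2 *\<^sub>R (u + (1/2) *\<^sub>R x)) = norm (u + (u + x))" by (rule arg_cong[where f = norm]) norm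
  also have "\<dots> \<le> 2" using norm_triangle_ineq[of u "u + x"] norm_u_le_1 \<open>norm (u + x) \<le> 1\<close> by linarith
  finally show ?thesis by (simp only: norm_scaleR)
qed

section \<open>The Peirce-2 space as a Jordan algebra with unit \<open>u\<close>, product
  \<open>tp x u y\<close> and involution \<open>Q\<close>\<close>

lemma Q_Q: "L b = b \<Longrightarrow> Q (Q b) = b"
  using QQ[of b] by (simp add: scaleR_2)

lemma tp_u_swap:
  assumes "L b = b"
  shows "tp b u y = tp u (Q b) y"
proof -
  have "tp u (Q b) (L y) = tp b u y - tp u (Q b) y + L (tp u (Q b) y)"
    using jordan[of u "Q b" u u y] by (simp add: Q_Q assms tp_commute[of "Q b" u u] LQ)
  moreover have "L (tp u (Q b) y) = tp u (Q b) y - tp u (Q b) y + tp u (Q b) (L y)"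
    using jordan[of u u u "Q b" y] by (simp add: tripotent_u LQ)
  ultimately show ?thesis by simp
qed

text \<open>The Jordan identity for \<open>tp (Q b) u\<close>, with \<open>b\<close> recovered as
  \<open>Q (Q b)\<close> in the middle term.\<close>

lemma tp_by_jordan_product:
  assumes "L b = b"
  shows "tp a b c = tp (tp (Q b) u a) u c + tp a u (tp (Q b) u c) - tp (Q b) u (tp a u c)"
  using jordan[of "Q b" u a u c] by (simp add: Q_Q assms)

text \<open>With \<open>y = Q x\<close>, both sides equal
  \<open>2 tp y u p - tp x u (tp y u y)\<close>. Preservation of cubes makes \<open>Q\<close>
  contractive on the Peirce-2 space.\<close>

lemma Q_cube:
  assumes x: "L x = x"
  shows "Q (tp x x x) = tp (Q x) (Q x) (Q x)"
proof -
  define y where "y = Q x"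
  have y: "L y = y" "Q y = x" by (simp_all add: y_def LQ Q_Q x)
  define p where "p = tp y u x"
  have p: "tp x x u = p"
    using tp_u_swap[OF y(1), of x] y(2) by (simp add: p_def tp_commute[of x x u])
  have up: "tp u x w = tp y u w" for w using tp_u_swap[OF y(1), of w] y(2) by simp
  have "tp x x y = tp p u y + tp x u (tp y u y) - tp y u (tp x u y)"
    using tp_by_jordan_product[OF x, of x y] by (simp add: y_def[symmetric] p_def)
  then have 1: "tp x x y = tp y u p + tp x u (tp y u y) - tp y u p"
    by (simp add: p_def tp_commute[of x u y] tp_commute[of "tp y u x" u y])
  have "tp y y y = tp (tp x u y) u y + tp y u (tp x u y) - tp x u (tp y u y)"
    using tp_by_jordan_product[OF y(1), of y y] by (simp add: y(2))
  then have 2: "tp y y y = tp y u p + tp y u p - tp x u (tp y u y)"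
    by (simp add: p_def tp_commute[of x u y] tp_commute[of "tp y u x" u y])
  have "tp x x y = tp p x u - Q (tp x x x) + tp u x p"
    using jordan[of x x u x u] by (simp add: p y_def tp_commute[of u x x])
  then have "tp x x y = tp y u p - Q (tp x x x) + tp y u p"
    using up by (simp add: tp_commute[of p x u])
  with 1 2 show ?thesis by (simp add: y_def[symmetric]) (simp add: algebra_simps)
qed

lemma norm_Q_le:
  assumes "L x = x"
  shows "norm (Q x) \<le> norm x"
proof -
  obtain K where K: "0 \<le> K" "\<And>x y z. norm (tp x y z) \<le> K * norm x * norm y * norm z" by (rule tp_bounded) blast
  show ?thesis
  proof (rule cube_hom_contractive[where A = "{x. L x = x}" and C = "K * norm u * norm u"])
    show "tp x x x \<in> {x. L x = x}" if "x \<in> {x. L x = x}" for x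
      using that peirce_rule[of x 1 x 1 x 1] by simp
  qed (use assms K(2)[of u _ u] in \<open>auto simp: Q_cube mult_ac\<close>)
qed

text \<open>Here \<open>u\<close> is the unit of the commutative algebra generated by the self-adjoint element \<open>b\<close>.\<close>

lemma unit_extreme_self_adjoint:
  assumes b: "L b = b" "Q b = b" and \<alpha>: "cmod \<alpha> = 1"
    and le: "norm (u + cs \<alpha> b) \<le> 1" "norm (u - cs \<alpha> b) \<le> 1"
  shows "b = 0"
proof -
  define z where "z k = (tp b u ^^ k) u" for k
  have z: "z 0 = u" "\<And>k. z (Suc k) = tp b u (z k)" by (simp_all add: z_def)
  have z1: "z 1 = b" using z(2)[of 0] by (simp add: z(1) tp_commute[of b u u] b One_nat_def)
  have swap: "tp b u y = tp u b y" for y using tp_u_swap[OF b(1), of y] b(2) by simp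
  have Lz: "L (z k) = z k" for k
  proof (induction k)
    case (Suc k)
    have "L (tp b u (z k)) = tp (L b) u (z k) - tp b (L u) (z k) + tp b u (L (z k))" by (rule jordan)
    then show ?case by (simp add: z(2) Suc b tripotent_u)
  qed (simp add: z(1) tripotent_u)
  have tp_z: "tp (z i) (z j) (z k) = z (i + j + k + 0)" for i j k
  proof (rule powers_associate[where V = "tp b u" and S = "tp b b"])
    show "tp b u (tp x y w) = tp (tp b u x) y w - tp x (tp b u y) w + tp x y (tp b u w)" for x y w
      using jordan[of b u x y w] by (simp only: swap[symmetric])
    show "tp b b (tp x y w) = tp (tp b b x) y w - tp x (tp b b y) w + tp x y (tp b b w)" for x y w
      by (rule jordan)
    show "tp (z 0) (z 0) (z k) = z (k + 0)" for k by (simp add: z(1) Lz)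
    show "((0::nat) = 1 \<and> (\<forall>k. tp b b (z k) = tp (z 1) (z 0) (z k)))
       \<or> ((0::nat) = 0 \<and> (\<forall>k. tp b b (z k) = tp (z 1) (z 1) (z k)) \<and> (\<forall>k. tp (z 1) (z 0) (z k) = z (Suc k)))"
      unfolding z1 by (simp add: z)
  qed (rule z(2))
  interpret cubic_seminorm "\<lambda>p. norm (ev z p)" 0
    by (rule cubic_seminorm_ev) (rule tp_z)
  have ev1: "ev z 1 = u" using ev_monom[of z 1 0] by (simp add: z(1))
  have bd: "bd p 1" if "norm (ev z p) \<le> 1" for p
    unfolding bd_def
  proof
    fix f
    have "norm (ev z (p * pcnj 1 * f * monom 1 0)) \<le> norm (ev z p) * norm (ev z 1) * norm (ev z f)" by (rule N_triple)
    also have "\<dots> \<le> 1 * norm (ev z f)"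
      unfolding ev1 by (intro mult_right_mono mult_le_one that norm_u_le_1) auto
    finally show "norm (ev z (p * f)) \<le> 1 * norm (ev z f)" by simp
  qed
  have "1 + [:0, \<alpha>:] = [:1, \<alpha>:]" "1 - [:0, \<alpha>:] = [:1, - \<alpha>:]" by (rule poly_ext, simp)+
  then have "ev z (1 + [:0, \<alpha>:]) = u + cs \<alpha> b" "ev z (1 - [:0, \<alpha>:]) = u - cs \<alpha> b"
    by (simp_all add: ev_pCons z(1) z1 cscale_def)
  then have "bd (1 + [:0, \<alpha>:]) 1" "bd (1 - [:0, \<alpha>:]) 1" using le by (auto intro: bd)
  then have "bd [:0, \<alpha>:] 0" by (rule unit_extreme)
  from bdD[OF this, of 1] have "ev z [:0, \<alpha>:] = 0" by simp
  then have "cs \<alpha> b = 0" by (simp add: ev_pCons z1)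
  then have "cmod \<alpha> * norm b = 0" by (metis norm_cs norm_zero)
  then show ?thesis using \<alpha> by simp
qed

text \<open>Since \<open>Q\<close> is contractive and fixes \<open>u\<close>, the self-adjoint part
  of \<open>x\<close> satisfies the same estimates and vanishes; the skew part that remains is
  \<open>i\<close> times a self-adjoint element.\<close>

lemma unit_extreme_peirce2:
  assumes x: "L x = x" and le: "norm (u + x) \<le> 1" "norm (u - x) \<le> 1"
  shows "x = 0"
proof -
  define a where "a = (1/2) *\<^sub>R (x + Q x)"
  have a: "L a = a" "Q a = a" by (simp_all add: a_def LQ Q_Q x add.commute)
  have "norm (u + cs 1 a) \<le> 1"
  proof -
    have "u + a = (1/2) *\<^sub>R ((u + x) + Q (u + x))" by (simp add: a_def tripotent_u) norm
    moreover have "norm (Q (u + x)) \<le> 1" using norm_Q_le[of "u + x"] le(1) x by (simp add: tripotent_u)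
    ultimately show ?thesis using le(1) norm_triangle_ineq[of "u + x" "Q (u + x)"] by (simp del: tp_linear)
  qed
  moreover have "norm (u - cs 1 a) \<le> 1"
  proof -
    have "u - a = (1/2) *\<^sub>R ((u - x) + Q (u - x))" by (simp add: a_def tripotent_u) norm
    moreover have "norm (Q (u - x)) \<le> 1" using norm_Q_le[of "u - x"] le(2) x by (simp add: tripotent_u)
    ultimately show ?thesis using le(2) norm_triangle_ineq[of "u - x" "Q (u - x)"] by (simp del: tp_linear)
  qed
  ultimately have "a = 0" by (intro unit_extreme_self_adjoint[of a 1] a) auto
  then have Qx: "Q x = - x" by (simp add: a_def eq_neg_iff_add_eq_0 add.commute)
  have "- J x = 0"
    by (rule unit_extreme_self_adjoint[of "- J x" \<i>]) (use x Qx le in simp_all)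
  then show ?thesis by (metis J_J J_linear(4) neg_0_equal_iff_equal neg_equal_0_iff_equal)
qed

lemma peirce_eigen:
  "L x = x \<Longrightarrow> peirce 2 x = x" "L x = x \<Longrightarrow> peirce 1 x = 0"
  "L x = (1/2) *\<^sub>R x \<Longrightarrow> peirce 2 x = 0" "L x = (1/2) *\<^sub>R x \<Longrightarrow> peirce 1 x = x"
  "L x = 0 \<Longrightarrow> peirce 2 x = 0" "L x = 0 \<Longrightarrow> peirce 1 x = 0"
proof -
  assume x: "L x = (1/2) *\<^sub>R x"
  show "peirce 1 x = x" by (simp add: peirce_def x) norm
qed (simp_all add: peirce_def scaleR_2)

lemmas peirce_linear = linear_add[OF linear_peirce] linear_diff[OF linear_peirce] linear_neg[OF linear_peirce] linear_scale[OF linear_peirce]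

section \<open>The Peirce-1 component\<close>

context
  fixes a assumes a: "L a = (1/2) *\<^sub>R a"
begin

lemma peirce_products:
  "tp u a u = 0" "L (tp a a u) = tp a a u" "L (tp a u a) = 0" "L (tp a a a) = (1/2) *\<^sub>R tp a a a"
  "tp a u (tp a u a) = 0"
proof -
  have u: "L u = 1 *\<^sub>R u" by (simp add: tripotent_u)
  show "tp u a u = 0" by (rule peirce_rule_zero[OF u a u]) simp
  show "L (tp a a u) = tp a a u" using peirce_rule[OF a a u] by simp
  show z: "L (tp a u a) = 0" using peirce_rule[OF a u a] by simp
  show "L (tp a a a) = (1/2) *\<^sub>R tp a a a" using peirce_rule[OF a a a] by simp
  show "tp a u (tp a u a) = 0" by (rule peirce_rule_zero[OF a u, where c = 0]) (use z in simp_all)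
qed

lemma cube_unit_plus:
  "tp (u + a) (u + a) (u + a) = u + a + 2 *\<^sub>R tp a a u + tp a u a + tp a a a"
proof -
  have "tp (u + a) (u + a) (u + a) = u + (1/2) *\<^sub>R a + (1/2) *\<^sub>R a + tp a a u + tp a a u + tp a u a + tp a a a"
    using a tp_commute[of a u u] tp_commute[of u a a] by (simp add: tripotent_u peirce_products(1) algebra_simps)
  then show ?thesis by simp norm
qed

text \<open>With \<open>y = u + a\<close> and \<open>h = tp a a u\<close>, the Peirce-2 part of \<open>y\<^sup>3\<close> is \<open>u + 2 h\<close> and that of
\<open>(3/2) y - (1/2) y\<^sup>3\<close> is \<open>u - h\<close>; both have norm at most one.\<close>

lemma peirce1_square_zero:
  assumes le: "norm (u + a) \<le> 1"
  shows "tp a a u = 0"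
proof -
  let ?h = "tp a a u" and ?y = "u + a"
  have 3: "peirce 2 (tp ?y ?y ?y) = u + 2 *\<^sub>R ?h"
    unfolding cube_unit_plus by (simp add: peirce_linear peirce_eigen tripotent_u peirce_products a)
  have y: "peirce 2 ?y = u" by (simp add: peirce_linear peirce_eigen tripotent_u a)
  have "norm (u + 2 *\<^sub>R ?h) \<le> norm (tp ?y ?y ?y)" unfolding 3[symmetric] by (rule norm_pp2_le)
  also have "\<dots> \<le> 1" using le by (simp only: norm_cube power_le_one norm_ge_zero)
  finally have 1: "norm (u + 2 *\<^sub>R ?h) \<le> 1" .
  have "peirce 2 ((3/2) *\<^sub>R ?y - (1/2) *\<^sub>R tp ?y ?y ?y) = (3/2) *\<^sub>R u - (1/2) *\<^sub>R (u + 2 *\<^sub>R ?h)"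
    by (simp only: peirce_linear(2,4) 3 y)
  also have "\<dots> = u - ?h" by norm
  finally have "norm (u - ?h) \<le> 1"
    using norm_pp2_le[of "(3/2) *\<^sub>R ?y - (1/2) *\<^sub>R tp ?y ?y ?y"] norm_three_halves_le[OF le] by simp
  moreover have "norm (u + ?h) \<le> 1"
    using norm_add_half_le[of "2 *\<^sub>R ?h"] 1 by simp
  ultimately show ?thesis by (intro unit_extreme_peirce2 peirce_products)
qed

end

text \<open>As \<open>tp a a u = 0\<close>, the cube of \<open>u + a\<close> has Peirce-2 part
  \<open>u\<close> and Peirce-1 part \<open>a + tp a a a\<close>. The Fejer mean puts
  \<open>u\<close> plus half of the latter into the unit ball, so \<open>peirce1_square_zero\<close>
  applies again.\<close>

lemma peirce1_cube_product_zero: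
  assumes a: "L a = (1/2) *\<^sub>R a" and le: "norm (u + a) \<le> 1"
  shows "2 *\<^sub>R tp (tp a a a) a u + tp (tp a a a) (tp a a a) u = 0"
proof -
  let ?c = "tp a a a" and ?y = "u + a"
  note pr = peirce_products[OF a]
  have h: "tp a a u = 0" by (rule peirce1_square_zero[OF a le])
  have "peirce 2 (tp ?y ?y ?y) + (1/2) *\<^sub>R peirce 1 (tp ?y ?y ?y) = u + (1/2) *\<^sub>R (a + ?c)"
    unfolding cube_unit_plus[OF a] h by (simp add: peirce_linear peirce_eigen tripotent_u pr a)
  then have "norm (u + (1/2) *\<^sub>R (a + ?c)) \<le> norm (tp ?y ?y ?y)" by (metis norm_fejer_le)
  also have "\<dots> \<le> 1" using le by (simp only: norm_cube power_le_one norm_ge_zero)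
  finally have "tp ((1/2) *\<^sub>R (a + ?c)) ((1/2) *\<^sub>R (a + ?c)) u = 0"
    by (rule peirce1_square_zero[rotated]) (simp add: a pr scaleR_add_right)
  then have "tp (a + ?c) (a + ?c) u = 0"
    by (simp add: linear_scale[OF linear_tp1] linear_scale[OF linear_tp2] del: tp_linear)
  then show ?thesis by (simp add: h tp_cube_swap[symmetric] scaleR_2 add_ac)
qed

text \<open>The Jordan identity and the vanishing products force \<open>tp a a (tp a a a) = 0\<close>.\<close>

lemma unit_extreme_peirce1:
  assumes a: "L a = (1/2) *\<^sub>R a" and le: "norm (u + a) \<le> 1"
  shows "a = 0"
proof -
  let ?c = "tp a a a" and ?z = "tp a u a" and ?q = "tp a u (tp a a a)"
  note pr = peirce_products[OF a]
  have h: "tp a a u = 0" by (rule peirce1_square_zero[OF a le])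
  have h': "tp u a a = 0" using h by (simp add: tp_commute[of u a a])
  have auu: "tp a u u = (1/2) *\<^sub>R a" using a by (simp add: tp_commute[of a u u])
  have g: "tp ?c a u = 0"
  proof -
    have 1: "2 *\<^sub>R tp ?c a u + tp ?c ?c u = 0" by (rule peirce1_cube_product_zero[OF a le])
    \<comment> \<open>The two terms of the first equation have degrees four and six in
      \<open>a\<close>, so its instance for \<open>a / 2\<close> separates them.\<close>
    have "norm (u + (1/2) *\<^sub>R a) \<le> 1" by (rule norm_add_half_le[OF le])
    then have "2 *\<^sub>R tp (tp ((1/2) *\<^sub>R a) ((1/2) *\<^sub>R a) ((1/2) *\<^sub>R a)) ((1/2) *\<^sub>R a) u
       + tp (tp ((1/2) *\<^sub>R a) ((1/2) *\<^sub>R a) ((1/2) *\<^sub>R a)) (tp ((1/2) *\<^sub>R a) ((1/2) *\<^sub>R a) ((1/2) *\<^sub>R a)) u = 0"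
      by (intro peirce1_cube_product_zero) (simp add: a)
    then have 2: "(1/8) *\<^sub>R tp ?c a u + (1/64) *\<^sub>R tp ?c ?c u = 0" by simp
    show ?thesis by (rule lin_comb2[OF 1 2, where a = "-1/6" and b = "64/6"]) norm
  qed
  have uaz: "tp u a ?z = - (1/2) *\<^sub>R ?c"
    using jordan[of u a a u a] by (simp add: h' auu)
  have aaz: "tp a a ?z = 2 *\<^sub>R ?q"
    using jordan[of a a a u a] by (simp add: h tp_commute[of ?c u a] scaleR_2)
  have "tp a u (tp u a ?z) = (1/2) *\<^sub>R tp a a ?z"
    using jordan[of a u u a ?z] by (simp add: auu h' pr(5))
  then have "- (1/2) *\<^sub>R ?q = ?q" unfolding uaz aaz by simp
  then have q: "?q = 0"
    by (rule lin_comb1[where a = "-2/3"]) norm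
  have "tp u a ?q = - (1/2) *\<^sub>R tp a a ?c"
    using jordan[of u a a u ?c] g by (simp add: h' auu tp_commute[of u a ?c])
  then have pw2: "odd_power a 2 = 0" using q by (simp add: numeral_2_eq_2 odd_power_Suc)
  \<comment> \<open>The odd power of index \<open>4\<close> is the cube of the one of index
    \<open>1\<close>, and it vanishes together with that of index \<open>2\<close>.\<close>
  have "(1 + 1 + 1 + 1 :: nat) = Suc (Suc 2)" by simp
  then have "odd_power a (1 + 1 + 1 + 1) = 0" by (simp only: odd_power_Suc pw2 tp_linear)
  then have "norm (odd_power a 1) ^ 3 = 0" using tp_odd_power[of a 1 1 1] norm_cube[of "odd_power a 1"] by (metis norm_zero)
  then have "odd_power a 1 = 0" by simp
  then have "tp a a a = 0" using odd_power_Suc[of a 0] by (simp add: One_nat_def)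
  then show ?thesis using norm_cube[of a] by simp
qed

text \<open>The Peirce-2 projection is contractive and fixes \<open>u\<close>, so the Peirce-2 part
  of \<open>x\<close> vanishes first. After that the Fejer mean of \<open>u + x\<close> is
  \<open>u\<close> plus half the Peirce-1 part.\<close>

lemma L_zero_if_norm_le:
  assumes "norm (u + x) \<le> 1" "norm (u - x) \<le> 1"
  shows "L x = 0"
proof -
  have u2: "peirce 2 u = u" "peirce 1 u = 0" by (simp_all add: peirce_eigen tripotent_u)
  have Lpp: "L (peirce 2 x) = peirce 2 x" "L (peirce 1 x) = (1/2) *\<^sub>R peirce 1 x" "L (peirce 0 x) = 0"
    using L_peirce[of 2 x] L_peirce[of 1 x] L_peirce[of 0 x] by simp_all
  have "norm (u + peirce 2 x) \<le> 1" "norm (u - peirce 2 x) \<le> 1"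
    using norm_pp2_le[of "u + x"] norm_pp2_le[of "u - x"] assms by (simp_all add: peirce_linear u2)
  then have "peirce 2 x = 0" by (rule unit_extreme_peirce2[OF Lpp(1)])
  moreover have "peirce 1 x = 0"
  proof -
    have "norm (u + (1/2) *\<^sub>R peirce 1 x) \<le> 1"
      using norm_fejer_le[of "u + x"] assms(1) by (simp add: peirce_linear u2 \<open>peirce 2 x = 0\<close>)
    then have "(1/2) *\<^sub>R peirce 1 x = 0" by (intro unit_extreme_peirce1) (simp_all add: Lpp)
    then show ?thesis by simp
  qed
  ultimately have "x = peirce 0 x" using x_eq_peirce[of x] by simp
  then show ?thesis using Lpp(3) by simp
qed

text \<open>One instance of the Jordan identity shows that \<open>L\<close> commutes with
  \<open>tp x u\<close>, another that the commutator is \<open>- tp x u\<close>.\<close>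

lemma orthogonal_if_L_zero:
  assumes "L x = 0"
  shows "tp x u y = 0"
proof -
  have Qx: "Q x = 0" using QL[of x] assms by simp
  have "L (tp x u y) = - tp x u y + tp x u (L y)"
    using jordan[of u u x u y] assms by (simp add: tripotent_u)
  moreover have "tp x u (L y) = L (tp x u y)"
    using jordan[of x u u u y] assms Qx by (simp add: tp_commute[of x u u])
  ultimately show ?thesis by simp
qed

end

section \<open>Direct sums with the maximum norm\<close>

lemma linf_sumD:
  assumes "linf_sum W M N"
  shows "subspace M" "subspace N" "\<And>m n. m \<in> M \<Longrightarrow> n \<in> N \<Longrightarrow> m + n \<in> W"
    "\<And>m n. m \<in> M \<Longrightarrow> n \<in> N \<Longrightarrow> norm (m + n) = max (norm m) (norm n)"
  using assms by (auto simp: linf_sum_def)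

lemma linf_sum_commute:
  assumes "linf_sum W M N"
  shows "linf_sum W N M"
proof -
  have "{m + n |m n. m \<in> N \<and> n \<in> M} = {m + n |m n. m \<in> M \<and> n \<in> N}"
    by (metis (no_types, opaque_lifting) add.commute)
  moreover have "norm (m + n) = max (norm m) (norm n)" if "m \<in> N" "n \<in> M" for m n
    using linf_sumD(4)[OF assms that(2,1)] by (simp add: add.commute max.commute)
  ultimately show ?thesis using assms by (simp add: linf_sum_def Int_commute)
qed

lemma linf_sumE:
  assumes "linf_sum W M N" "x \<in> W"
  obtains m n where "m \<in> M" "n \<in> N" "x = m + n"
  using assms by (auto simp: linf_sum_def)

lemma extreme_point_of_ballI:
  fixes x :: "'a::real_normed_vector"
  assumes "subspace V" "x \<in> V" "norm x \<le> 1"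
    and ext: "\<And>y. y \<in> V \<Longrightarrow> norm (x + y) \<le> 1 \<Longrightarrow> norm (x - y) \<le> 1 \<Longrightarrow> y = 0"
  shows "x extreme_point_of (V \<inter> cball 0 1)"
  unfolding extreme_point_of_def
proof (intro conjI ballI notI)
  fix a b assume ab: "a \<in> V \<inter> cball 0 1" "b \<in> V \<inter> cball 0 1" "x \<in> open_segment a b"
  then obtain t where t: "0 < t" "t < 1" "x = (1 - t) *\<^sub>R a + t *\<^sub>R b" and ne: "a \<noteq> b"
    by (auto simp: in_segment)
  \<comment> \<open>Both \<open>t + s\<close> and \<open>t - s\<close> stay in the unit interval, so
    \<open>x\<close> can move by \<open>s (b - a)\<close> in either direction.\<close>
  define s where "s = min t (1 - t)"
  have conv: "norm ((1 - r) *\<^sub>R a + r *\<^sub>R b) \<le> 1" if "0 \<le> r" "r \<le> 1" for r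
    using convexD[OF convex_cball[of 0 1], of a b "1 - r" r] ab that by auto
  have eq: "x + s *\<^sub>R (b - a) = (1 - (t + s)) *\<^sub>R a + (t + s) *\<^sub>R b"
    "x - s *\<^sub>R (b - a) = (1 - (t - s)) *\<^sub>R a + (t - s) *\<^sub>R b"
    unfolding t(3) by (simp_all add: algebra_simps)
  have "norm (x + s *\<^sub>R (b - a)) \<le> 1" "norm (x - s *\<^sub>R (b - a)) \<le> 1"
    unfolding eq using t by (intro conv; simp add: s_def)+
  moreover have "s *\<^sub>R (b - a) \<in> V" using ab assms(1) by (auto intro: subspace_scale subspace_diff)
  ultimately have "s *\<^sub>R (b - a) = 0" by (intro ext)
  then show False using t ne by (auto simp: s_def min_def split: if_splits)
qed (use assms in auto)

text \<open>The cube of \<open>m\<close> is known only to lie in \<open>W\<close>, so its difference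
  from \<open>m\<close> is split along \<open>M\<close> and \<open>N\<close>, and the two components
  are excluded separately.\<close>

lemma (in jb_triple) summand_tripotent:
  assumes sum: "linf_sum W M N" and W: "subspace W" "tp m m m \<in> W"
    and m: "m \<in> M" "norm m \<le> 1"
    and ext: "\<And>x. x \<in> M \<Longrightarrow> norm (m + x) \<le> 1 \<Longrightarrow> norm (m - x) \<le> 1 \<Longrightarrow> x = 0"
  shows "tp m m m = m"
proof (rule ccontr)
  assume "tp m m m \<noteq> m"
  define y where "y = m - tp m m m"
  have y0: "y \<noteq> 0" using \<open>tp m m m \<noteq> m\<close> by (simp add: y_def)
  note [intro] = linf_sumD(1,2)[OF sum]
  have "m \<in> W" using linf_sumD(3)[OF sum m(1), of 0] by (simp add: subspace_0 linf_sumD(2)[OF sum])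
  then have "y \<in> W" unfolding y_def by (intro subspace_diff W)
  then obtain p q where pq: "p \<in> M" "q \<in> N" "y = p + q" by (rule linf_sumE[OF sum])
  have "norm (m + (1/2) *\<^sub>R y) \<le> 1"
  proof -
    have "m + (1/2) *\<^sub>R y = (3/2) *\<^sub>R m - (1/2) *\<^sub>R tp m m m" unfolding y_def by norm
    then show ?thesis using norm_three_halves_le[OF m(2)] by simp
  qed
  moreover have "m + (1/2) *\<^sub>R y = (m + (1/2) *\<^sub>R p) + (1/2) *\<^sub>R q" by (simp add: pq(3) scaleR_add_right add.assoc)
  moreover have "m + (1/2) *\<^sub>R p \<in> M" "(1/2) *\<^sub>R q \<in> N"
    using m pq by (auto intro: subspace_add subspace_scale)
  ultimately have 1: "norm (m + (1/2) *\<^sub>R p) \<le> 1" using linf_sumD(4)[OF sum] by (metis max.bounded_iff)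
  have "norm (m - (1/2) *\<^sub>R y) \<le> 1"
  proof -
    have "2 *\<^sub>R (m - (1/2) *\<^sub>R y) = m + tp m m m" unfolding y_def by norm
    moreover have "norm (tp m m m) \<le> 1" using m(2) by (simp add: norm_cube power_le_one)
    ultimately have "norm (2 *\<^sub>R (m - (1/2) *\<^sub>R y)) \<le> 2" using norm_triangle_ineq[of m "tp m m m"] m(2) by simp
    then show ?thesis by (simp only: norm_scaleR)
  qed
  moreover have "m - (1/2) *\<^sub>R y = (m - (1/2) *\<^sub>R p) + (- (1/2)) *\<^sub>R q" by (simp add: pq(3) scaleR_add_right)
  moreover have "m - (1/2) *\<^sub>R p \<in> M" "(- (1/2)) *\<^sub>R q \<in> N"
    using m pq by (auto intro!: subspace_diff intro: subspace_scale simp del: scaleR_minus_left)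
  ultimately have "norm (m - (1/2) *\<^sub>R p) \<le> 1" using linf_sumD(4)[OF sum] by (metis max.bounded_iff)
  with 1 have "(1/2) *\<^sub>R p = 0" using pq by (intro ext) (auto intro: subspace_scale)
  then have yN: "y \<in> N" using pq by simp
  \<comment> \<open>Now \<open>c y\<close> is a unit vector of \<open>N\<close>, so the maximum norm
    keeps \<open>m + c y\<close> in the unit ball, while \<open>norm_diff_cube_le\<close> would then
    force \<open>sqrt (c\<^sup>2 + 1) \<le> c\<close>.\<close>
  define c where "c = 1 / norm y"
  have c: "0 < c" "c * norm y = 1" using y0 by (simp_all add: c_def)
  have "c *\<^sub>R y \<in> N" using yN by (auto intro: subspace_scale)
  then have "norm (m + c *\<^sub>R y) \<le> 1" using linf_sumD(4)[OF sum m(1)] m(2) c by simp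
  then have "sqrt (c\<^sup>2 + 1) * norm y \<le> c * norm y"
    using norm_diff_cube_le[OF m(2) c(1)] unfolding y_def[symmetric] c(2) by simp
  moreover have "c < sqrt (c\<^sup>2 + 1)" by (rule real_less_rsqrt) simp
  ultimately show False using y0 by simp
qed

theorem theorem3p5:
  fixes J :: "'a::banach \<Rightarrow> 'a" and tp :: "'a \<Rightarrow> 'a \<Rightarrow> 'a \<Rightarrow> 'a"
    and W M N :: "'a set" and P :: "'a \<Rightarrow> 'a"
    and \<Phi> :: "('b::banach \<Rightarrow>\<^sub>L real) \<Rightarrow> 'a" and e :: 'a
  assumes "real_JB_star_triple J tp W"
    and "dual_space_via \<Phi> W"
    and "linf_sum W M N" and "M \<noteq> {0}" and "N \<noteq> {0}"
    and "\<forall>m\<in>M. \<forall>n\<in>N. P (m + n) = m"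
    and "complete_tripotent tp W e"
  shows "tripotent tp (P e) \<and> tripotent tp (e - P e) \<and> P e \<noteq> 0 \<and> e - P e \<noteq> 0
    \<and> orthogonal_in tp W (P e) (e - P e)
    \<and> (P e) extreme_point_of (M \<inter> cball 0 1)
    \<and> (e - P e) extreme_point_of (N \<inter> cball 0 1)"
proof -
  have W: "subspace W" "\<And>x. x \<in> W \<Longrightarrow> tp x x x \<in> W"
    and jb: "JB_star_triple J tp"
    using assms(1) by (auto simp: real_JB_star_triple_def)
  have e: "e \<in> W" "tp e e e = e" "\<And>x. x \<in> W \<Longrightarrow> tp e e x = 0 \<Longrightarrow> x = 0"
    using assms(7) by (auto simp: complete_tripotent_def tripotent_def peirce0_def)
  interpret E: tripotent_element J tp e by unfold_locales (fact jb, fact e(2))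
  have ext: "x = 0" if "x \<in> W" "norm (e + x) \<le> 1" "norm (e - x) \<le> 1" for x
    using e(3) that E.L_zero_if_norm_le by blast

  have summand: "norm a \<le> 1 \<and> a \<noteq> 0 \<and> tp a a a = a \<and> a extreme_point_of (A \<inter> cball 0 1)"
    if sum: "linf_sum W A B" and AB: "a \<in> A" "b \<in> B" "e = a + b" and "A \<noteq> {0}" for A B a b
  proof -
    note S = linf_sumD[OF sum]
    have sub: "A \<subseteq> W" using S(3)[of _ 0] subspace_0[OF S(2)] by auto
    have norms: "norm a \<le> 1" "norm b \<le> 1"
      using S(4)[OF AB(1,2)] E.norm_u_le_1 by (simp_all add: AB(3))
    have extA: "x = 0" if x: "x \<in> A" "norm (a + x) \<le> 1" "norm (a - x) \<le> 1" for x
    proof (rule ext)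
      show "x \<in> W" using x(1) sub by blast
      have eq: "e + x = (a + x) + b" "e - x = (a - x) + b" by (simp_all add: AB(3))
      have "a + x \<in> A" "a - x \<in> A" using S(1) AB(1) x(1) by (auto intro: subspace_add subspace_diff)
      then show "norm (e + x) \<le> 1" "norm (e - x) \<le> 1"
        unfolding eq using S(4)[OF _ AB(2)] x norms by simp_all
    qed
    have "a \<noteq> 0"
    proof
      assume "a = 0"
      obtain x where "x \<in> A" "x \<noteq> 0" using \<open>A \<noteq> {0}\<close> AB(1) by blast
      \<comment> \<open>If \<open>a = 0\<close>, a unit vector of \<open>A\<close> and its negative
        satisfy the premises of \<open>extA\<close>.\<close>
      then have "(1 / norm x) *\<^sub>R x = 0" by (intro extA subspace_scale[OF S(1)]) (simp_all add: \<open>a = 0\<close>)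
      with \<open>x \<noteq> 0\<close> show False by simp
    qed
    moreover have "tp a a a = a"
      by (rule E.summand_tripotent[OF sum W(1) _ AB(1) norms(1) extA]) (use AB(1) sub W(2) in auto)
    ultimately show ?thesis using extreme_point_of_ballI[OF S(1) AB(1) norms(1) extA] norms by blast
  qed

  obtain m n where mn: "m \<in> M" "n \<in> N" "e = m + n" using linf_sumE[OF assms(3) e(1)] by blast
  then have P: "P e = m" "e - P e = n" using assms(6) by auto
  have m: "norm m \<le> 1" "m \<noteq> 0" "tp m m m = m" "m extreme_point_of (M \<inter> cball 0 1)"
    using summand[OF assms(3) mn assms(4)] by blast+
  have n: "norm n \<le> 1" "n \<noteq> 0" "tp n n n = n" "n extreme_point_of (N \<inter> cball 0 1)"
    using summand[OF linf_sum_commute[OF assms(3)] mn(2,1) _ assms(5)] mn(3) by (auto simp: add.commute)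
  interpret N: tripotent_element J tp n by unfold_locales (fact n(3))
  note S = linf_sumD[OF assms(3)]
  \<comment> \<open>The maximum norm does not see the sign of \<open>m\<close>, so the estimate for
    the tripotent \<open>n\<close> applies to the perturbation \<open>m\<close>.\<close>
  have "norm (n + m) \<le> 1" using S(4)[OF mn(1,2)] m n by (simp add: add.commute)
  moreover have "norm (n - m) \<le> 1"
    using S(4)[OF subspace_neg[OF S(1) mn(1)] mn(2)] m n by (simp add: add.commute)
  ultimately have "tp n n m = 0" by (rule N.L_zero_if_norm_le)
  then have "orthogonal_in tp W m n" by (simp add: orthogonal_in_def N.orthogonal_if_L_zero)
  with m n show ?thesis unfolding P(2) unfolding P(1) tripotent_def by blast
qed

end
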